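(* Let $1<\ell<m$, let $\delta=\ell(m-\ell)$, and let $\eta=(m-\ell,\,m-\ell+2,\,m-\ell+3,\dots,m)$. Then the higher weights of the Schubert code $C_\eta(\ell,m)$ are $$d_r(C_\eta(\ell,m))=q^{\delta-1}+q^{\delta-2}+\dots+q^{\delta-r}\quad\text{for } 1\le r\le\max\{\ell,m-\ell\}.$$ In particular, the minimum distance is $d_1(C_\eta(\ell,m))=q^{\delta-1}=q^{\delta_\eta}$, where $\delta_\eta=\sum_{i=1}^\ell(\eta_i-i)$.
   Context: $\mathbb{F}_q$ is the finite field with $q$ elements, $V=\mathbb{F}_q^m$ with standard basis $e_1,\dots,e_m$, $A_j=\mathrm{span}(e_1,\dots,e_j)$. $G_{\ell,m}$ is the Grassmannian of $\ell$-dimensional subspaces of $V$; for $\alpha=(\alpha_1<\dots<\alpha_\ell)$, $\Omega_\alpha=\{W\in G_{\ell,m}:\dim(W\cap A_{\alpha_i})\ge i,\ i=1,\dots,\ell\}$ ($\Omega_\eta$ is the Schubert divisor of $G_{\ell,m}$). The Schubert code $C_\alpha(\ell,m)$ is the nondegenerate linear code associated with the projective system $X$ of $\mathbb{F}_q$-rational points of $\Omega_\alpha$ under the Plücker embedding $W\mapsto[w_1\wedge\dots\wedge w_\ell]\in\mathbb{P}(\wedge^\ell V)$, viewed inside the projective linear span $\mathbb{P}^{k-1}$ of $X$. Its $r$-th higher weight is $d_r=|X|-\max\{|X\cap\Pi|:\Pi \text{ a linear subspace of } \mathbb{P}^{k-1} \text{ of codimension } r\}$, which coincides with the minimum, over $r$-dimensional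 subcodes $D$, of the number of coordinates at which some element of $D$ is nonzero; $d_1$ is the minimum distance. *)

theory Defs
  imports "HOL-Library.Cardinality" "HOL-Library.Function_Algebras" "Jordan_Normal_Form.Determinant"
begin

text \<open>
  Coordinate spaces are spaces of functions \<open>'i \<Rightarrow> 'a\<close> with pointwise operations.  The finite field
  of \<open>q\<close> elements is a type \<open>'a::{field,finite}\<close> with \<open>q = CARD('a)\<close>.
\<close>

definition fscale :: "'a::field \<Rightarrow> ('i \<Rightarrow> 'a) \<Rightarrow> 'i \<Rightarrow> 'a" where
  "fscale c v = (\<lambda>i. c * v i)"

interpretation fv: vector_space "fscale :: 'a::field \<Rightarrow> ('i \<Rightarrow> 'a) \<Rightarrow> 'i \<Rightarrow> 'a"
  by unfold_locales (auto simp: fscale_def fun_eq_iff algebra_simps)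


section \<open>Grassmannians and Schubert varieties\<close>

text \<open>Indices of coordinates run through \<open>{1..m}\<close>; all other coordinates are zero.\<close>

definition coord_space :: "nat \<Rightarrow> (nat \<Rightarrow> 'a::field) set" where
  "coord_space m = {v. \<forall>i. i \<notin> {1..m} \<longrightarrow> v i = 0}"

definition std_basis :: "nat \<Rightarrow> nat \<Rightarrow> 'a::field" where
  "std_basis i = (\<lambda>k. if k = i then 1 else 0)"

definition flag :: "nat \<Rightarrow> (nat \<Rightarrow> 'a::field) set" where
  "flag j = fv.span (std_basis ` {1..j})"

definition grassmannian :: "nat \<Rightarrow> nat \<Rightarrow> (nat \<Rightarrow> 'a::field) set set" where
  "grassmannian l m = {W. fv.subspace W \<and> W \<subseteq> coord_space m \<and> fv.dim W = l}"

text \<open>Only the values of \<open>\<alpha>\<close> on \<open>{1..l}\<close> matter.\<close>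

definition schubert_variety ::
  "nat \<Rightarrow> nat \<Rightarrow> (nat \<Rightarrow> nat) \<Rightarrow> (nat \<Rightarrow> 'a::field) set set" where
  "schubert_variety l m \<alpha> =
     {W \<in> grassmannian l m. \<forall>i\<in>{1..l}. i \<le> fv.dim (W \<inter> flag (\<alpha> i))}"

definition divisor_index :: "nat \<Rightarrow> nat \<Rightarrow> nat \<Rightarrow> nat" where
  "divisor_index l m i = (if i = 1 then m - l else m - l + i)"

definition index_dim :: "nat \<Rightarrow> (nat \<Rightarrow> nat) \<Rightarrow> nat" where
  "index_dim l \<alpha> = (\<Sum>i=1..l. \<alpha> i - i)"


section \<open>The Pluecker embedding\<close>

text \<open>
  The \<open>l\<close>-th exterior power is coordinatised by its basis of the vectors
  \<open>e_I = e_(i_1) \<and> \<dots> \<and> e_(i_l)\<close> for \<open>I = {i_1 < \<dots> < i_l}\<close>, so that its elements are functions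
  \<open>nat set \<Rightarrow> 'a\<close> supported on \<open>l\<close>-element sets.  The coefficient of \<open>e_I\<close> in
  \<open>w_1 \<and> \<dots> \<and> w_l\<close> is the minor of the matrix with rows \<open>w_1, \<dots>, w_l\<close> in the columns \<open>I\<close>.
  For vectors in \<open>coord_space m\<close> it vanishes unless \<open>I \<subseteq> {1..m}\<close>.
\<close>

definition wedge :: "(nat \<Rightarrow> 'a::field) list \<Rightarrow> nat set \<Rightarrow> 'a" where
  "wedge ws = (\<lambda>I. if finite I \<and> card I = length ws
     then det (mat (length ws) (length ws) (\<lambda>(a, b). (ws ! a) (sorted_list_of_set I ! b)))
     else 0)"

definition ordered_basis :: "('i \<Rightarrow> 'a::field) set \<Rightarrow> ('i \<Rightarrow> 'a) list \<Rightarrow> bool" where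
  "ordered_basis W ws \<longleftrightarrow> distinct ws \<and> fv.independent (set ws) \<and> fv.span (set ws) = W"

text \<open>
  A point of a projective space is a line through the origin, as a set of vectors: \<open>[x]\<close> is
  \<open>fv.span {x}\<close> for \<open>x \<noteq> 0\<close>.  The line \<open>[w_1 \<and> \<dots> \<and> w_l]\<close> does not depend on the basis of
  \<open>W\<close>, so each \<open>W\<close> contributes exactly one point below.
\<close>

definition schubert_system ::
  "nat \<Rightarrow> nat \<Rightarrow> (nat \<Rightarrow> nat) \<Rightarrow> (nat set \<Rightarrow> 'a::field) set set" where
  "schubert_system l m \<alpha> =
     {fv.span {wedge ws} | W ws. W \<in> schubert_variety l m \<alpha> \<and> ordered_basis W ws}"


section \<open>Codes of projective systems\<close>

text \<open>
  The projective span of a set \<open>X\<close> of points is the projective space of the linear span of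
  \<open>\<Union>X\<close>.  Its linear subspaces of codimension \<open>r\<close> correspond to the linear subspaces
  \<open>U\<close> of codimension \<open>r\<close> of that vector space, and a point \<open>p\<close> lies on it iff \<open>p \<subseteq> U\<close>.  The empty
  projective subspace (\<open>U = {0}\<close>) is allowed; it has codimension \<open>k\<close> in the projective space of
  dimension \<open>k - 1\<close>.  The value is meaningful for finite \<open>X\<close> and \<open>r \<le> k\<close> only.
\<close>

definition higher_weight :: "('i \<Rightarrow> 'a::field) set set \<Rightarrow> nat \<Rightarrow> nat" where
  "higher_weight X r = card X -
     Max {card {p \<in> X. p \<subseteq> U} | U. fv.subspace U \<and> U \<subseteq> fv.span (\<Union>X) \<and>
                                     fv.dim U + r = fv.dim (fv.span (\<Union>X))}"

text \<open>
  The code of a projective system depends, up to equivalence, on a choice \<open>rep\<close> of a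
  representative vector of each point; its words are the evaluations of linear forms at these
  representatives, and its coordinates are indexed by \<open>X\<close> itself.
\<close>

definition representatives :: "('i \<Rightarrow> 'a::field) set set \<Rightarrow> (('i \<Rightarrow> 'a) set \<Rightarrow> 'i \<Rightarrow> 'a) \<Rightarrow> bool"
  where "representatives X rep \<longleftrightarrow> (\<forall>p\<in>X. rep p \<in> p \<and> rep p \<noteq> 0)"

definition system_code ::
  "('i \<Rightarrow> 'a::field) set set \<Rightarrow> (('i \<Rightarrow> 'a) set \<Rightarrow> 'i \<Rightarrow> 'a) \<Rightarrow> (('i \<Rightarrow> 'a) set \<Rightarrow> 'a) set" where
  "system_code X rep =
     {(\<lambda>p. if p \<in> X then f (rep p) else 0) | f. Vector_Spaces.linear fscale (*) f}"

definition hamming_dist :: "('p \<Rightarrow> 'a) \<Rightarrow> ('p \<Rightarrow> 'a) \<Rightarrow> nat" where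
  "hamming_dist c d = card {p. c p \<noteq> d p}"

definition min_distance :: "('p \<Rightarrow> 'a) set \<Rightarrow> nat" where
  "min_distance C = Min {hamming_dist c d | c d. c \<in> C \<and> d \<in> C \<and> c \<noteq> d}"

end

theory Submission
  imports Defs
begin

text \<open>
  The Schubert divisor is the hyperplane section of the Grassmannian on which the Pluecker coordinate
  of \<open>{m-l+1..m}\<close> vanishes; the complement of this section is an affine space with \<open>q^\<delta>\<close> points.

  Lower bound: a nonzero alternating \<open>l\<close>-form on \<open>F_q^m\<close> is nonzero on at least
  \<open>(q^m - q^(m-1)) \<dots> (q^m - q^(m-l))\<close> tuples, because its radical has codimension at least \<open>l\<close>, and
  fixing a vector outside the radical leaves a nonzero \<open>(l-1)\<close>-form.  Dividing by the number of ordered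
  bases of an \<open>l\<close>-space, every hyperplane misses at least \<open>q^\<delta>\<close> points of the Grassmannian.
  Averaging over the hyperplanes through a subspace of codimension \<open>r + 1\<close> shows that it misses at least
  \<open>q^\<delta> + \<dots> + q^(\<delta>-r)\<close> points, and the first term is the complement of the divisor.

  Equality: take the coordinate subspace on which the coordinates of \<open>r + 1\<close> sets, any two of which
  differ by an exchange of one element, vanish.  In the affine chart of one of these sets the
  other coordinates are, up to sign, distinct entries of the reduced basis, so each vanishing
  condition costs a factor \<open>q\<close>.
\<close>

section \<open>Linear algebra over a finite field\<close>

text \<open>The span of the divisor is a hyperplane of the exterior power, so codimension r there
  means codimension s = r + 1 in the exterior power. The bound is therefore proved on the whole
  Grassmannian, where a hyperplane is just an alternating form without a Schubert condition. It
  transfers back without loss because the divisor itself is a hyperplane section missing the fewest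
  points. The shape of the sum comes from the averaging: q^s - 1 nonzero functionals vanish on the
  subspace, each is nonzero at q^\<delta> points or more, and a point outside is seen by at most q^s
  - q^(s - 1) of them. The quotient of (q^s - 1) q^\<delta> by q^s - q^(s - 1) is exactly q^\<delta>
  + ... + q^(\<delta> - r). The range of r comes from the exchange family: l-sets that pairwise
  differ by one exchange form a clique of the Johnson graph, and its two kinds of maximal cliques
  have m - l + 1 and l + 1 members. Fibres and charts are only bounded from above, by injectivity;
  equality arises where the two bounds meet.\<close>

lemma card_field_ge_2: "2 \<le> CARD('a::{field,finite})"
proof -
  have "card {0, 1::'a} \<le> CARD('a)" by (rule card_mono) auto
  then show ?thesis by simp
qed

lemma card_le_fibres:
  assumes "finite T" "f ` S \<subseteq> T" "finite S" "\<And>t. t \<in> T \<Longrightarrow> card {s \<in> S. f s = t} \<le> k"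
  shows "card S \<le> k * card T"
proof -
  have "S = (\<Union>t\<in>T. {s \<in> S. f s = t})" using assms(2) by auto
  then have "card S \<le> (\<Sum>t\<in>T. card {s \<in> S. f s = t})"
    using card_UN_le[OF assms(1), of "\<lambda>t. {s \<in> S. f s = t}"] by simp
  also have "\<dots> \<le> card T * k" using sum_bounded_above[of T _ k] assms(4) by simp
  finally show ?thesis by (simp add: mult.commute)
qed

text \<open>The pairs (c, x) with x in \<open>fv.span S\<close> correspond bijectively to the sums x
  + c b. Repeated use turns independence into powers of q, also relative to a radical for which no
  basis is chosen.\<close>

lemma card_span_insert:
  fixes b :: "'i \<Rightarrow> 'a::{field,finite}"
  assumes "b \<notin> fv.span S"
  shows "card (fv.span (insert b S)) = CARD('a) * card (fv.span S)"
    and "finite (fv.span S) \<Longrightarrow> finite (fv.span (insert b S))"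
proof -
  let ?h = "\<lambda>(c, x). x + fscale c b"
  have inj: "inj_on ?h (UNIV \<times> fv.span S)"
  proof (rule inj_onI, clarsimp)
    fix c x d y assume x: "x \<in> fv.span S" and y: "y \<in> fv.span S"
      and e: "x + fscale c b = y + fscale d b"
    have e': "fscale (c - d) b = y - x"
      using e by (simp add: fv.scale_left_diff_distrib algebra_simps)
    have "c = d"
    proof (rule ccontr)
      assume "c \<noteq> d"
      then have "b = fscale (inverse (c - d)) (fscale (c - d) b)" by simp
      also have "\<dots> \<in> fv.span S"
        unfolding e' by (intro fv.span_scale fv.span_diff x y)
      finally show False using assms by simp
    qed
    then show "c = d \<and> x = y" using e by simp
  qed
  have im: "?h ` (UNIV \<times> fv.span S) = fv.span (insert b S)"
  proof
    show "?h ` (UNIV \<times> fv.span S) \<subseteq> fv.span (insert b S)"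
    proof (rule image_subsetI, clarify)
      fix c x assume "x \<in> fv.span S"
      then have "x \<in> fv.span (insert b S)" using fv.span_mono[OF subset_insertI[of S b]] by blast
      then show "x + fscale c b \<in> fv.span (insert b S)"
        by (rule fv.span_add) (intro fv.span_scale fv.span_base insertI1)
    qed
    show "fv.span (insert b S) \<subseteq> ?h ` (UNIV \<times> fv.span S)"
    proof
      fix x assume "x \<in> fv.span (insert b S)"
      then obtain k where "x - fscale k b \<in> fv.span S" by (auto simp: fv.span_insert)
      then show "x \<in> ?h ` (UNIV \<times> fv.span S)"
        by (intro image_eqI[of _ _ "(k, x - fscale k b)"]) auto
    qed
  qed
  show "card (fv.span (insert b S)) = CARD('a) * card (fv.span S)"
    using card_image[OF inj] by (simp add: im card_cartesian_product)
  show "finite (fv.span (insert b S))" if "finite (fv.span S)"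
    using im that by (metis finite_cartesian_product finite_imageI finite)
qed

lemma card_span_independent:
  fixes B :: "('i \<Rightarrow> 'a::{field,finite}) set"
  assumes "finite B" "fv.independent B"
  shows "finite (fv.span B) \<and> card (fv.span B) = CARD('a) ^ card B"
  using assms
proof (induction B)
  case (insert b B)
  then have "b \<notin> fv.span B" "fv.independent B" by (auto simp: fv.independent_insert)
  with insert card_span_insert[of b B] show ?case by auto
qed simp

lemma finite_span:
  fixes B :: "('i \<Rightarrow> 'a::{field,finite}) set"
  assumes "finite B"
  shows "finite (fv.span B)"
proof -
  obtain C where "C \<subseteq> B" "fv.independent C" "B \<subseteq> fv.span C"
    using fv.maximal_independent_subset[of B] by blast
  moreover from this have "fv.span B \<subseteq> fv.span C"
    by (metis fv.span_minimal fv.subspace_span)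
  ultimately show ?thesis
    using card_span_independent[of C] assms finite_subset by blast
qed

lemma card_subspace:
  fixes U :: "('i \<Rightarrow> 'a::{field,finite}) set"
  assumes "fv.subspace U" "finite U"
  shows "card U = CARD('a) ^ fv.dim U"
proof -
  obtain B where B: "B \<subseteq> U" "fv.independent B" "U \<subseteq> fv.span B" "card B = fv.dim U"
    using fv.basis_exists by blast
  then have "fv.span B = U" using assms by (simp add: fv.span_subspace)
  then show ?thesis using card_span_independent[of B] B finite_subset[OF B(1) assms(2)] by simp
qed

section \<open>Coordinate subspaces\<close>

text \<open>One notion for the ambient space, the flag, the exterior power (indexed by sets) and the
  span of the divisor.\<close>

definition supp_space :: "'i set \<Rightarrow> ('i \<Rightarrow> 'a::field) set" where
  "supp_space S = {v. \<forall>i. i \<notin> S \<longrightarrow> v i = 0}"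

definition unit_fun :: "'i \<Rightarrow> 'i \<Rightarrow> 'a::field" where
  "unit_fun i = (\<lambda>k. if k = i then 1 else 0)"

lemma subspace_supp_space: "fv.subspace (supp_space S)"
  by (auto simp: fv.subspace_def supp_space_def fscale_def)

lemma supp_space_basis:
  assumes "finite S"
  shows "fv.independent (unit_fun ` S :: ('i \<Rightarrow> 'a::field) set)
    \<and> fv.span (unit_fun ` S) = (supp_space S :: ('i \<Rightarrow> 'a) set)"
  using assms
proof (induction S)
  case empty
  have "supp_space {} = {0 :: 'i \<Rightarrow> 'a}" by (auto simp: supp_space_def)
  then show ?case by (simp add: fv.dependent_def)
next
  case (insert i S)
  have "(unit_fun i :: 'i \<Rightarrow> 'a) \<notin> supp_space S"
    using insert.hyps by (auto simp: supp_space_def unit_fun_def)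
  then have "fv.independent (insert (unit_fun i) (unit_fun ` S) :: ('i \<Rightarrow> 'a) set)"
    using insert.IH by (intro fv.independent_insertI) auto
  moreover have "fv.span (insert (unit_fun i) (unit_fun ` S)) = (supp_space (insert i S) :: ('i \<Rightarrow> 'a) set)"
  proof
    show "fv.span (insert (unit_fun i) (unit_fun ` S)) \<subseteq> (supp_space (insert i S) :: ('i \<Rightarrow> 'a) set)"
      by (intro fv.span_minimal subspace_supp_space) (auto simp: supp_space_def unit_fun_def)
    show "(supp_space (insert i S) :: ('i \<Rightarrow> 'a) set) \<subseteq> fv.span (insert (unit_fun i) (unit_fun ` S))"
    proof
      fix x :: "'i \<Rightarrow> 'a" assume x: "x \<in> supp_space (insert i S)"
      then have "x - fscale (x i) (unit_fun i) \<in> supp_space S"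
        by (auto simp: supp_space_def unit_fun_def fscale_def)
      then show "x \<in> fv.span (insert (unit_fun i) (unit_fun ` S))"
        using insert.IH by (auto simp: fv.span_insert)
    qed
  qed
  ultimately show ?case by simp
qed

lemma dim_supp_space:
  assumes "finite S"
  shows "fv.dim (supp_space S :: ('i \<Rightarrow> 'a::field) set) = card S"
proof -
  have "inj_on (unit_fun :: 'i \<Rightarrow> 'i \<Rightarrow> 'a) S"
    by (rule inj_onI) (metis unit_fun_def zero_neq_one)
  then show ?thesis
    using supp_space_basis[OF assms, where 'a = 'a] fv.dim_eq_card_independent fv.dim_span
    by (metis card_image)
qed

lemma finite_supp_space:
  assumes "finite S"
  shows "finite (supp_space S :: ('i \<Rightarrow> 'a::{field,finite}) set)"
  using finite_span[of "unit_fun ` S :: ('i \<Rightarrow> 'a) set"] supp_space_basis[OF assms, where 'a = 'a] assms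
  by simp

lemma card_supp_space:
  assumes "finite S"
  shows "card (supp_space S :: ('i \<Rightarrow> 'a::{field,finite}) set) = CARD('a) ^ card S"
  using card_subspace[OF subspace_supp_space finite_supp_space[OF assms]] dim_supp_space[OF assms]
  by metis

text \<open>A basis of the kernel together with x0 is a basis of E, since x - (f x / f x0) x0 lies
  in the kernel. Serves the minimum distance, where words give functionals rather than
  subspaces.\<close>

lemma dim_kernel:
  fixes f :: "('i \<Rightarrow> 'a::{field,finite}) \<Rightarrow> 'a"
  assumes f: "Vector_Spaces.linear fscale (*) f" and E: "fv.subspace E" "finite E"
    and x0: "x0 \<in> E" "f x0 \<noteq> 0"
  shows "fv.dim {x \<in> E. f x = 0} + 1 = fv.dim E" "fv.subspace {x \<in> E. f x = 0}"
proof -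
  interpret f: Vector_Spaces.linear fscale "(*)" f by (rule f)
  show sub: "fv.subspace {x \<in> E. f x = 0}"
    using E(1) by (auto simp: fv.subspace_def f.add f.scale f.zero)
  obtain B where B: "B \<subseteq> {x \<in> E. f x = 0}" "fv.independent B" "{x \<in> E. f x = 0} \<subseteq> fv.span B"
      "card B = fv.dim {x \<in> E. f x = 0}"
    using fv.basis_exists by blast
  have sB: "fv.span B = {x \<in> E. f x = 0}" by (rule fv.span_subspace[OF B(1,3) sub])
  have finB: "finite B" using E(2) by (intro finite_subset[OF B(1)]) simp
  have n: "x0 \<notin> fv.span B" using sB x0 by simp
  then have ind: "fv.independent (insert x0 B)" using B by (intro fv.independent_insertI)
  have "fv.span (insert x0 B) = E"
  proof
    show "fv.span (insert x0 B) \<subseteq> E" using B x0 E by (intro fv.span_minimal) auto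
    show "E \<subseteq> fv.span (insert x0 B)"
    proof
      fix x assume x: "x \<in> E"
      have "x - fscale (f x / f x0) x0 \<in> {x \<in> E. f x = 0}"
        using x x0 E by (auto simp: f.diff f.scale intro!: fv.subspace_diff fv.subspace_scale)
      then show "x \<in> fv.span (insert x0 B)" using sB by (auto simp: fv.span_insert)
    qed
  qed
  then have "fv.dim E = card (insert x0 B)"
    using ind fv.dim_eq_card_independent fv.dim_span by metis
  moreover have "x0 \<notin> B" using n fv.span_base by blast
  ultimately show "fv.dim {x \<in> E. f x = 0} + 1 = fv.dim E"
    using finB B(4) by (metis card_insert_disjoint Suc_eq_plus1)
qed

section \<open>Independent tuples and their number\<close>

abbreviation ind_list :: "('i \<Rightarrow> 'a::field) list \<Rightarrow> bool" where
  "ind_list ws \<equiv> distinct ws \<and> fv.independent (set ws)"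

lemma ind_list_Cons: "ind_list (w # ws) \<longleftrightarrow> w \<notin> fv.span (set ws) \<and> ind_list ws"
  using fv.independent_insert[of w "set ws"] fv.span_base[of w "set ws"] by auto

lemma card_span_ind_list:
  fixes ws :: "('i \<Rightarrow> 'a::{field,finite}) list"
  assumes "ind_list ws"
  shows "card (fv.span (set ws)) = CARD('a) ^ length ws"
  using card_span_independent[of "set ws"] assms by (simp add: distinct_card)

lemma finite_lists_length: "finite W \<Longrightarrow> finite {ws. length ws = k \<and> set ws \<subseteq> W \<and> P ws}"
  by (rule finite_subset[OF _ finite_lists_length_eq[of W k]]) auto

lemma card_lists_Suc:
  assumes "finite W"
  shows "card {ws. length ws = Suc k \<and> set ws \<subseteq> W \<and> P ws} =
    (\<Sum>w\<in>W. card {ws. length ws = k \<and> set ws \<subseteq> W \<and> P (w # ws)})"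
proof -
  have "{ws. length ws = Suc k \<and> set ws \<subseteq> W \<and> P ws} =
      (\<lambda>(w, ws). w # ws) ` (SIGMA w:W. {ws. length ws = k \<and> set ws \<subseteq> W \<and> P (w # ws)})"
    (is "?A = ?h ` ?S")
  proof (intro subset_antisym subsetI)
    fix x assume "x \<in> ?A"
    then show "x \<in> ?h ` ?S" by (cases x) (auto simp: image_iff)
  qed auto
  moreover have "inj_on ?h ?S" by (auto simp: inj_on_def)
  ultimately show ?thesis using assms by (simp add: card_image finite_lists_length)
qed

text \<open>Each new vector avoids the span of the k vectors already chosen, which has q^k elements.
  For k beyond the dimension the formula stays right, as one factor is 0.\<close>

lemma card_ind_lists:
  fixes W :: "('i \<Rightarrow> 'a::{field,finite}) set"
  assumes W: "fv.subspace W" "finite W"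
  shows "card {ws. length ws = k \<and> set ws \<subseteq> W \<and> ind_list ws} = (\<Prod>i<k. card W - CARD('a) ^ i)"
proof (induction k)
  case 0
  have "{ws. length ws = 0 \<and> set ws \<subseteq> W \<and> ind_list ws} = {[]}" by (auto simp: fv.dependent_def)
  then show ?case by simp
next
  case (Suc k)
  let ?L = "{ws. length ws = k \<and> set ws \<subseteq> W \<and> ind_list ws}"
  have "{ws. length ws = Suc k \<and> set ws \<subseteq> W \<and> ind_list ws} =
      (\<lambda>(ws, w). w # ws) ` (SIGMA ws:?L. W - fv.span (set ws))" (is "?A = ?h ` ?S")
  proof (intro subset_antisym subsetI)
    fix x assume "x \<in> ?A"
    then show "x \<in> ?h ` ?S" using ind_list_Cons by (cases x) (fastforce simp: image_iff)+
  next
    fix x assume "x \<in> ?h ` ?S"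
    then obtain w ws where x: "x = w # ws" "ws \<in> ?L" "w \<in> W" "w \<notin> fv.span (set ws)" by auto
    then have "ind_list x" by (simp only: ind_list_Cons) simp
    then show "x \<in> ?A" using x by auto
  qed
  moreover have "inj_on ?h ?S" by (auto simp: inj_on_def)
  ultimately have "card {ws. length ws = Suc k \<and> set ws \<subseteq> W \<and> ind_list ws} = card ?S"
    by (simp add: card_image)
  also have "\<dots> = (\<Sum>ws\<in>?L. card (W - fv.span (set ws)))"
    using W by (intro card_SigmaI) (auto simp: finite_lists_length)
  also have "\<dots> = (\<Sum>ws\<in>?L. card W - CARD('a) ^ k)"
  proof (rule sum.cong)
    fix ws assume ws: "ws \<in> ?L"
    have "fv.span (set ws) \<subseteq> W" using ws W by (intro fv.span_minimal) auto
    then have "card (W - fv.span (set ws)) = card W - card (fv.span (set ws))"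
      using W by (intro card_Diff_subset) (auto elim: finite_subset)
    then show "card (W - fv.span (set ws)) = card W - CARD('a) ^ k"
      using ws card_span_ind_list[of ws] by auto
  qed simp
  finally show ?case using Suc by (simp add: mult.commute)
qed

section \<open>Alternating forms\<close>

text \<open>Forms are functions on lists, constrained only at length n; a slot is addressed by
  splitting the list. Arguments range over all coordinate functions, and restriction to a subspace
  is left to the counting lemmas.\<close>

definition alt_form :: "nat \<Rightarrow> (('i \<Rightarrow> 'a::field) list \<Rightarrow> 'a) \<Rightarrow> bool" where
  "alt_form n f \<longleftrightarrow>
    (\<forall>xs ys x y. length xs + length ys + 1 = n \<longrightarrow> f (xs @ (x + y) # ys) = f (xs @ x # ys) + f (xs @ y # ys)) \<and>
    (\<forall>xs ys c x. length xs + length ys + 1 = n \<longrightarrow> f (xs @ fscale c x # ys) = c * f (xs @ x # ys)) \<and>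
    (\<forall>ws. length ws = n \<longrightarrow> \<not> distinct ws \<longrightarrow> f ws = 0)"

text \<open>This is the contraction of the form by w; it drives the induction on the number of
  arguments.\<close>

lemma alt_form_Cons:
  assumes "alt_form (Suc n) f"
  shows "alt_form n (\<lambda>ws. f (w # ws))"
proof -
  have "f (w # xs @ (x + y) # ys) = f (w # xs @ x # ys) + f (w # xs @ y # ys)"
      "f (w # xs @ fscale c x # ys) = c * f (w # xs @ x # ys)"
    if "length xs + length ys + 1 = n" for xs ys x y c
    using assms that unfolding alt_form_def by (metis append_Cons length_Cons add_Suc)+
  moreover have "f (w # ws) = 0" if "length ws = n" "\<not> distinct ws" for ws
    using assms that unfolding alt_form_def by simp
  ultimately show ?thesis by (simp add: alt_form_def)
qed

lemma alt_form_zero_span: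
  assumes f: "alt_form n f" and n: "length xs + length ys + 1 = n"
    and S: "\<And>s. s \<in> S \<Longrightarrow> f (xs @ s # ys) = 0" and x: "x \<in> fv.span S"
  shows "f (xs @ x # ys) = 0"
  using x
proof (induction rule: fv.span_induct_alt)
  case base
  have "f (xs @ fscale 0 0 # ys) = 0 * f (xs @ 0 # ys)"
    using f n unfolding alt_form_def by blast
  then show ?case by (simp only: fv.scale_zero_left mult_zero_left)
next
  case (step c s y)
  have "f (xs @ (fscale c s + y) # ys) = f (xs @ fscale c s # ys) + f (xs @ y # ys)"
    using f n unfolding alt_form_def by blast
  also have "f (xs @ fscale c s # ys) = c * f (xs @ s # ys)"
    using f n unfolding alt_form_def by blast
  finally show ?case using S step by simp
qed

lemma alt_form_eq_0_span:
  assumes f: "alt_form n f" and n: "length xs + length ys + 1 = n"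
    and x: "x \<in> fv.span (set xs \<union> set ys)"
  shows "f (xs @ x # ys) = 0"
proof (rule alt_form_zero_span[OF f n _ x])
  fix s assume "s \<in> set xs \<union> set ys"
  then show "f (xs @ s # ys) = 0" using f n unfolding alt_form_def by auto
qed

lemma alt_form_ind_list:
  assumes f: "alt_form n f" and n: "length ws = n" and nz: "f ws \<noteq> 0"
  shows "ind_list ws"
proof
  show d: "distinct ws" using assms unfolding alt_form_def by blast
  show "fv.independent (set ws)"
  proof
    assume "fv.dependent (set ws)"
    then obtain w where w: "w \<in> set ws" "w \<in> fv.span (set ws - {w})"
      unfolding fv.dependent_def by blast
    obtain xs ys where ws: "ws = xs @ w # ys" using w(1) split_list by fastforce
    then have "set ws - {w} = set xs \<union> set ys" using d by auto
    then have "f ws = 0" using alt_form_eq_0_span[OF f, of xs ys w] w n ws by simp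
    then show False using nz by simp
  qed
qed

text \<open>Polarisation: expand the value at x + y in both slots. One of the slots is the first
  because the radical is defined through the first argument, and its vectors have to be moved
  there.\<close>

lemma alt_form_swap:
  assumes f: "alt_form (Suc n) f" and n: "length xs + length ys + 1 = n"
  shows "f (y # xs @ x # ys) = - f (x # xs @ y # ys)"
proof -
  have add1: "f ((u + v) # zs) = f (u # zs) + f (v # zs)" if "length zs = n" for u v zs
    using f that unfolding alt_form_def by (metis append_Nil list.size(3) add_0 Suc_eq_plus1)
  have add2: "f (z # xs @ (u + v) # ys) = f (z # xs @ u # ys) + f (z # xs @ v # ys)" for u v z
    using alt_form_Cons[OF f, of z] n unfolding alt_form_def by blast
  have same: "f (u # xs @ u # ys) = 0" for u
    using f n unfolding alt_form_def by auto
  have "0 = f ((x + y) # xs @ (x + y) # ys)" by (simp add: same)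
  also have "\<dots> = f (x # xs @ y # ys) + f (y # xs @ x # ys)"
    using n by (simp add: add1 add2 same[of x] same[of y])
  finally have "f (y # xs @ x # ys) + f (x # xs @ y # ys) = 0" by (metis add.commute)
  then show ?thesis by (simp only: eq_neg_iff_add_eq_0)
qed

text \<open>The vectors on which a nonzero alternating \<open>n\<close>-form does not vanish are linearly independent
  modulo its radical.\<close>

lemma card_radical:
  fixes V :: "('i \<Rightarrow> 'a::{field,finite}) set"
  assumes V: "fv.subspace V" "finite V" and f: "alt_form n f"
    and vs: "length vs = n" "set vs \<subseteq> V" "f vs \<noteq> 0" and n: "n = Suc n'"
  defines "R \<equiv> {w \<in> V. \<forall>ws. length ws = n' \<and> set ws \<subseteq> V \<longrightarrow> f (w # ws) = 0}"
  shows "CARD('a) ^ n * card R \<le> card V"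
proof -
  have R: "fv.subspace R"
  proof -
    have "f ([] @ (x + y) # ws) = f ([] @ x # ws) + f ([] @ y # ws)"
        "f ([] @ fscale c x # ws) = c * f ([] @ x # ws)" if "length ws = n'" for x y c ws
      using f n that unfolding alt_form_def by (metis Suc_eq_plus1 add_0 list.size(3))+
    moreover from this(2)[of _ 0 0] have "f (0 # ws) = 0" if "length ws = n'" for ws
      using that by simp
    ultimately show ?thesis
      using V(1) unfolding fv.subspace_def R_def by auto
  qed
  \<comment> \<open>A vector of the radical kills the form in every slot: a swap brings it to the
    front, up to sign.\<close>
  have R0: "f (xs @ r # ys) = 0"
    if "r \<in> R" "length xs + length ys + 1 = n" "set xs \<subseteq> V" "set ys \<subseteq> V" for r xs ys
  proof (cases xs)
    case Nil
    then show ?thesis using that n by (auto simp: R_def)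
  next
    case (Cons x xs')
    then have "f (xs @ r # ys) = - f (r # xs' @ x # ys)"
      using alt_form_swap[of n' f xs' ys x r] f that n by simp
    also have "f (r # xs' @ x # ys) = 0" using that n Cons by (auto simp: R_def)
    finally show ?thesis by simp
  qed
  have finR: "finite R" using V(2) by (auto simp: R_def)
  \<comment> \<open>Adjoin the entries of vs to R one at a time. Were \<open>vs ! k\<close> in the
    span so far, linearity in slot k would reduce \<open>f vs\<close> to values with a radical
    vector or a repeated entry, hence to 0.\<close>
  have "finite (fv.span (R \<union> set (take k vs))) \<and>
      card (fv.span (R \<union> set (take k vs))) = CARD('a) ^ k * card R" if "k \<le> n" for k
    using that
  proof (induction k)
    case 0
    have "fv.span R = R" using R by (simp only: fv.span_eq_iff)
    then have "fv.span (R \<union> set (take 0 vs)) = R" by (simp del: fv.span_eq_iff)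
    then show ?case using finR by (simp only: power_0 mult_1 simp_thms)
  next
    case (Suc k)
    have split: "vs = take k vs @ vs ! k # drop (Suc k) vs"
      using Suc.prems vs(1) by (simp add: id_take_nth_drop)
    have len: "length (take k vs) + length (drop (Suc k) vs) + 1 = n" using Suc.prems vs(1) by simp
    have "vs ! k \<notin> fv.span (R \<union> set (take k vs))"
    proof
      assume k: "vs ! k \<in> fv.span (R \<union> set (take k vs))"
      have "f (take k vs @ vs ! k # drop (Suc k) vs) = 0"
      proof (rule alt_form_zero_span[OF f len _ k])
        fix s assume "s \<in> R \<union> set (take k vs)"
        then show "f (take k vs @ s # drop (Suc k) vs) = 0"
        proof
          assume "s \<in> R"
          then show ?thesis using vs(2) len by (intro R0) (auto dest: in_set_takeD in_set_dropD)
        next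
          assume "s \<in> set (take k vs)"
          then show ?thesis using f len unfolding alt_form_def by auto
        qed
      qed
      then show False using vs(3) split by simp
    qed
    moreover have "R \<union> set (take (Suc k) vs) = insert (vs ! k) (R \<union> set (take k vs))"
      using Suc.prems vs(1) by (simp add: take_Suc_conv_app_nth)
    ultimately show ?case
      using Suc card_span_insert[of "vs ! k" "R \<union> set (take k vs)"] by auto
  qed
  from this[of n] have "card (fv.span (R \<union> set vs)) = CARD('a) ^ n * card R" using vs(1) by simp
  moreover have "fv.span (R \<union> set vs) \<subseteq> V"
    using V vs(2) by (intro fv.span_minimal) (auto simp: R_def)
  ultimately show ?thesis using card_mono[OF V(2)] by metis
qed

text \<open>Induction on \<open>n\<close>: fixing the first argument outside the radical leaves a nonzero
  \<open>(n - 1)\<close>-form.  The bound is attained by determinants.\<close>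

lemma card_alt_form_nonzero:
  fixes V :: "('i \<Rightarrow> 'a::{field,finite}) set"
  assumes V: "fv.subspace V" "finite V" "card V = CARD('a) ^ m"
    and f: "alt_form n f" and vs: "length vs = n" "set vs \<subseteq> V" "f vs \<noteq> 0"
  shows "(\<Prod>i=1..n. CARD('a) ^ m - CARD('a) ^ (m - i))
    \<le> card {ws. length ws = n \<and> set ws \<subseteq> V \<and> f ws \<noteq> 0}"
  using f vs
proof (induction n arbitrary: f vs)
  case 0
  then have "{ws. length ws = 0 \<and> set ws \<subseteq> V \<and> f ws \<noteq> 0} = {[]}" by auto
  then show ?case by simp
next
  case (Suc n)
  define R where "R = {w \<in> V. \<forall>ws. length ws = n \<and> set ws \<subseteq> V \<longrightarrow> f (w # ws) = 0}"
  let ?q = "CARD('a)"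
  let ?P = "\<Prod>i=1..n. ?q ^ m - ?q ^ (m - i)"
  have q: "?q \<ge> 2" by (rule card_field_ge_2)
  have R0: "0 \<in> R"
  proof -
    have "f ([] @ fscale 0 0 # ws) = 0 * f ([] @ 0 # ws)" if "length ws = n" for ws
      using Suc.prems(1) that unfolding alt_form_def by (metis Suc_eq_plus1 add_0 list.size(3))
    then show ?thesis using V by (simp add: R_def fv.subspace_0)
  qed
  have finR: "finite R" using V(2) by (auto simp: R_def)
  then have R1: "card R \<ge> 1" using R0 by (metis card_0_eq empty_iff less_one not_le)
  have le: "?q ^ Suc n * card R \<le> ?q ^ m"
    using card_radical[OF V(1,2) Suc.prems refl] V(3) by (simp add: R_def)
  have "?q ^ Suc n * 1 \<le> ?q ^ Suc n * card R" using R1 by (rule mult_le_mono2)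
  then have "?q ^ Suc n \<le> ?q ^ m" using le by linarith
  \<comment> \<open>The mere existence of a nonzero form forces this; it makes m - Suc n an honest
    difference below.\<close>
  then have nm: "Suc n \<le> m" using q by (subst (asm) power_increasing_iff) auto
  have "?q ^ m = ?q ^ Suc n * ?q ^ (m - Suc n)" using nm by (metis le_add_diff_inverse power_add)
  then have "?q ^ Suc n * card R \<le> ?q ^ Suc n * ?q ^ (m - Suc n)" using le by (simp only:)
  then have R: "card R \<le> ?q ^ (m - Suc n)" using q by (simp only: mult_le_cancel1) simp
  have "(\<Prod>i=1..Suc n. ?q ^ m - ?q ^ (m - i)) = (?q ^ m - ?q ^ (m - Suc n)) * ?P"
    by (simp add: mult.commute)
  also have "\<dots> \<le> card (V - R) * ?P"
  proof -
    have "card (V - R) = ?q ^ m - card R"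
      using V finR by (subst card_Diff_subset) (auto simp: R_def)
    then show ?thesis using R by (intro mult_right_mono) auto
  qed
  also have "\<dots> \<le> (\<Sum>w\<in>V - R. card {ws. length ws = n \<and> set ws \<subseteq> V \<and> f (w # ws) \<noteq> 0})"
  proof -
    have "?P \<le> card {ws. length ws = n \<and> set ws \<subseteq> V \<and> f (w # ws) \<noteq> 0}" if w: "w \<in> V - R" for w
    proof -
      obtain ws where "length ws = n" "set ws \<subseteq> V" "f (w # ws) \<noteq> 0" using w by (auto simp: R_def)
      then show ?thesis using Suc.IH[OF alt_form_Cons[OF Suc.prems(1)]] by blast
    qed
    then show ?thesis using sum_mono[of "V - R" "\<lambda>_. ?P"] by simp
  qed
  also have "\<dots> \<le> (\<Sum>w\<in>V. card {ws. length ws = n \<and> set ws \<subseteq> V \<and> f (w # ws) \<noteq> 0})"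
    using V by (intro sum_mono2) auto
  also have "\<dots> = card {ws. length ws = Suc n \<and> set ws \<subseteq> V \<and> f ws \<noteq> 0}"
    using card_lists_Suc[OF V(2), of n "\<lambda>ws. f ws \<noteq> 0"] by simp
  finally show ?case .
qed

section \<open>Minors and Pluecker coordinates\<close>

lemma sum_fun_apply: "(sum F A) x = (\<Sum>i\<in>A. F i x)"
  for F :: "'k \<Rightarrow> 'i \<Rightarrow> 'a::comm_monoid_add"
  by (induction A rule: infinite_finite_induct) auto

text \<open>Columns form a list, not a set, so that one can be prepended, repeated or left unsorted;
  \<open>wedge\<close> is the sorted case and \<open>minor_eq_wedge\<close> relates the two.\<close>

definition minor :: "('i \<Rightarrow> 'a::field) list \<Rightarrow> 'i list \<Rightarrow> 'a" where
  "minor ws js = det (mat (length ws) (length ws) (\<lambda>(a, b). (ws ! a) (js ! b)))"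

lemma wedge_eq_minor:
  "wedge ws I = (if finite I \<and> card I = length ws then minor ws (sorted_list_of_set I) else 0)"
  by (simp add: wedge_def minor_def)

text \<open>The coefficients are the cofactors along the row of x. Deleting that row removes x, so
  they depend on the other rows only; linearity in each slot follows from this form.\<close>

lemma minor_row:
  obtains c where "\<And>x. minor (xs @ x # ys) js = (\<Sum>j<length xs + length ys + 1. x (js ! j) * c j)"
proof -
  let ?n = "length xs + length ys + 1" and ?k = "length xs"
  define A where "A x = mat ?n ?n (\<lambda>(a, b). ((xs @ x # ys) ! a) (js ! b))" for x
  have cof: "cofactor (A x) ?k j = cofactor (A 0) ?k j" for x j
  proof -
    have "mat_delete (A x) ?k j = mat_delete (A 0) ?k j"
      by (rule eq_matI) (auto simp: mat_delete_def A_def nth_append nth_Cons')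
    then show ?thesis by (simp add: cofactor_def)
  qed
  have "minor (xs @ x # ys) js = (\<Sum>j<?n. x (js ! j) * cofactor (A 0) ?k j)" for x
  proof -
    have "minor (xs @ x # ys) js = det (A x)" by (simp add: minor_def A_def)
    also have "\<dots> = (\<Sum>j<?n. A x $$ (?k, j) * cofactor (A x) ?k j)"
      by (rule laplace_expansion_row) (auto simp: A_def)
    also have "\<dots> = (\<Sum>j<?n. x (js ! j) * cofactor (A 0) ?k j)"
    proof (rule sum.cong)
      fix j assume "j \<in> {..<?n}"
      then have "A x $$ (?k, j) = x (js ! j)" by (simp add: A_def)
      then show "A x $$ (?k, j) * cofactor (A x) ?k j = x (js ! j) * cofactor (A 0) ?k j"
        by (simp only: cof[of x])
    qed simp
    finally show ?thesis .
  qed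
  then show ?thesis using that by blast
qed

lemma alt_form_minor: "alt_form n (\<lambda>ws. minor ws js)"
  unfolding alt_form_def
proof (intro conjI allI impI)
  fix xs ys :: "('a \<Rightarrow> 'b) list" and x y
  obtain c where "\<And>x. minor (xs @ x # ys) js = (\<Sum>j<length xs + length ys + 1. x (js ! j) * c j)"
    using minor_row[of xs ys js] by blast
  then show "minor (xs @ (x + y) # ys) js = minor (xs @ x # ys) js + minor (xs @ y # ys) js"
    by (simp only: plus_fun_apply distrib_right sum.distrib)
next
  fix xs ys :: "('a \<Rightarrow> 'b) list" and d x
  obtain c where "\<And>x. minor (xs @ x # ys) js = (\<Sum>j<length xs + length ys + 1. x (js ! j) * c j)"
    using minor_row[of xs ys js] by blast
  then show "minor (xs @ fscale d x # ys) js = d * minor (xs @ x # ys) js"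
    by (simp only: fscale_def sum_distrib_left mult.assoc)
next
  fix ws :: "('a \<Rightarrow> 'b) list" assume "\<not> distinct ws"
  then obtain i j where "i < length ws" "j < length ws" "i \<noteq> j" "ws ! i = ws ! j"
    by (auto simp: distinct_conv_nth)
  then show "minor ws js = 0"
    unfolding minor_def by (intro det_identical_rows[of _ "length ws" i j]) (auto intro!: eq_vecI)
qed

lemma minor_not_distinct:
  assumes "length js = length ws" "\<not> distinct js"
  shows "minor ws js = 0"
proof -
  obtain i j where "i < length ws" "j < length ws" "i \<noteq> j" "js ! i = js ! j"
    using assms by (auto simp: distinct_conv_nth)
  then show ?thesis
    unfolding minor_def by (intro det_identical_columns[of _ "length ws" i j]) (auto intro!: eq_vecI)
qed

lemma minor_zero_column:
  assumes "length js = length ws" "j \<in> set js" "\<And>w. w \<in> set ws \<Longrightarrow> w j = 0"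
  shows "minor ws js = 0"
proof -
  obtain b where b: "b < length ws" "js ! b = j" using assms(1,2) by (metis in_set_conv_nth)
  let ?n = "length ws"
  let ?A = "mat ?n ?n (\<lambda>(a, b). (ws ! a) (js ! b))"
  have "minor ws js = (\<Sum>i<?n. ?A $$ (i, b) * cofactor ?A i b)"
    unfolding minor_def by (rule laplace_expansion_column) (use b in auto)
  also have "\<dots> = 0" using b assms(3) by (intro sum.neutral) auto
  finally show ?thesis .
qed

text \<open>The scalar is the sign of the permutation that sorts js. What matters is that it depends
  on js alone, so that one factor serves for different tuples.\<close>

lemma minor_eq_wedge:
  assumes "distinct js"
  obtains s :: "'a::field" where "s \<noteq> 0"
    "\<And>ws. length ws = length js \<Longrightarrow> minor ws js = s * wedge ws (set js)"
proof -
  let ?n = "length js" and ?ss = "sorted_list_of_set (set js)"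
  have "mset js = mset ?ss"
    using assms by (metis set_eq_iff_mset_eq_distinct distinct_sorted_list_of_set finite_set set_sorted_list_of_set)
  then obtain p where p: "p permutes {..<length ?ss}" "permute_list p ?ss = js"
    using mset_eq_permutation by metis
  have len: "length ?ss = ?n" using p(2) by (metis length_permute_list)
  then have p': "p permutes {0..<?n}" using p(1) by (simp add: atLeast0LessThan)
  have js: "js ! b = ?ss ! p b" if "b < ?n" for b
    using p permute_list_nth[OF p(1)] that len by simp
  have "minor ws js = signof p * wedge ws (set js)" if ws: "length ws = ?n" for ws :: "(nat \<Rightarrow> 'a) list"
  proof -
    \<comment> \<open>Transposing turns the permutation of columns into a permutation of
      rows.\<close>
    define A where "A = mat ?n ?n (\<lambda>(b, a). (ws ! a) (?ss ! b))"
    have "minor ws js = det (transpose_mat (mat ?n ?n (\<lambda>(i, j). A $$ (p i, j))))"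
      unfolding minor_def ws
      by (intro arg_cong[where f = det] eq_matI)
        (use permutes_in_image[OF p'] in \<open>auto simp: A_def js\<close>)
    also have "\<dots> = det (mat ?n ?n (\<lambda>(i, j). A $$ (p i, j)))"
      by (rule det_transpose[of _ ?n]) simp
    also have "\<dots> = signof p * det A" by (rule det_permute_rows[OF _ p']) (simp add: A_def)
    also have "det A = det (transpose_mat A)" by (rule det_transpose[of _ ?n, symmetric]) (simp add: A_def)
    also have "transpose_mat A = mat ?n ?n (\<lambda>(a, b). (ws ! a) (?ss ! b))"
      by (rule eq_matI) (auto simp: A_def)
    also have "det \<dots> = wedge ws (set js)"
      using assms ws by (simp add: wedge_def distinct_card)
    finally show ?thesis .
  qed
  moreover have "(signof p :: 'a) \<noteq> 0" by (simp add: sign_def)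
  ultimately show ?thesis by (rule that[rotated])
qed

lemma minor_nonzero_distinct:
  "length js = length ws \<Longrightarrow> minor ws js \<noteq> 0 \<Longrightarrow> distinct js"
  using minor_not_distinct by blast

section \<open>Laplace expansions, and minors as a test for the span\<close>

lemma minor_first_row:
  assumes "length ks = Suc (length ws)"
  shows "minor (v # ws) ks =
    (\<Sum>k<Suc (length ws). v (ks ! k) * ((-1) ^ k * minor ws (take k ks @ drop (Suc k) ks)))"
proof -
  let ?n = "length ws"
  define A where "A = mat (Suc ?n) (Suc ?n) (\<lambda>(a, b). ((v # ws) ! a) (ks ! b))"
  have "minor (v # ws) ks = det A" by (simp add: minor_def A_def)
  also have "\<dots> = (\<Sum>k<Suc ?n. A $$ (0, k) * cofactor A 0 k)"
    by (rule laplace_expansion_row) (auto simp: A_def)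
  also have "\<dots> = (\<Sum>k<Suc ?n. v (ks ! k) * ((-1) ^ k * minor ws (take k ks @ drop (Suc k) ks)))"
  proof (rule sum.cong)
    fix k assume k: "k \<in> {..<Suc ?n}"
    have "mat_delete A 0 k = mat ?n ?n (\<lambda>(a, b). (ws ! a) ((take k ks @ drop (Suc k) ks) ! b))"
    proof (rule eq_matI)
      fix i j assume "i < dim_row (mat ?n ?n (\<lambda>(a, b). (ws ! a) ((take k ks @ drop (Suc k) ks) ! b)))"
        "j < dim_col (mat ?n ?n (\<lambda>(a, b). (ws ! a) ((take k ks @ drop (Suc k) ks) ! b)))"
      then have ij: "i < ?n" "j < ?n" by simp_all
      have "(take k ks @ drop (Suc k) ks) ! j = ks ! (if j < k then j else Suc j)"
        using k assms ij by (simp add: nth_append)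
      then show "mat_delete A 0 k $$ (i, j) =
          mat ?n ?n (\<lambda>(a, b). (ws ! a) ((take k ks @ drop (Suc k) ks) ! b)) $$ (i, j)"
        using ij by (simp add: mat_delete_def A_def)
    qed (simp_all add: mat_delete_def A_def)
    then have "cofactor A 0 k = (-1) ^ k * minor ws (take k ks @ drop (Suc k) ks)"
      by (simp add: cofactor_def minor_def)
    then show "A $$ (0, k) * cofactor A 0 k =
        v (ks ! k) * ((-1) ^ k * minor ws (take k ks @ drop (Suc k) ks))"
      using k by (simp add: A_def)
  qed simp
  finally show ?thesis .
qed

lemma minor_first_column:
  obtains c where "\<And>a. minor (v # ws) (a # js) = v a * minor ws js + (\<Sum>i<length ws. (ws ! i) a * c i)"
proof -
  let ?n = "length ws"
  define A where "A x = mat (Suc ?n) (Suc ?n) (\<lambda>(a, b). ((v # ws) ! a) ((x # js) ! b))" for x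
  have cof: "cofactor (A x) i 0 = cofactor (A y) i 0" for x y i
  proof -
    have "mat_delete (A x) i 0 = mat_delete (A y) i 0"
      by (rule eq_matI) (simp_all add: mat_delete_def A_def)
    then show ?thesis by (simp add: cofactor_def)
  qed
  \<comment> \<open>The value at \<open>undefined\<close> is an arbitrary choice: by
    \<open>cof\<close> the cofactors do not see the first column.\<close>
  define c where "c i = cofactor (A undefined) (Suc i) 0" for i
  have "minor (v # ws) (a # js) = v a * minor ws js + (\<Sum>i<?n. (ws ! i) a * c i)" for a
  proof -
    have "minor (v # ws) (a # js) = det (A a)" by (simp add: minor_def A_def)
    also have "\<dots> = (\<Sum>i<Suc ?n. A a $$ (i, 0) * cofactor (A a) i 0)"
      by (rule laplace_expansion_column) (auto simp: A_def)
    also have "\<dots> = A a $$ (0, 0) * cofactor (A a) 0 0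
        + (\<Sum>i<?n. A a $$ (Suc i, 0) * cofactor (A a) (Suc i) 0)"
      by (rule sum.lessThan_Suc_shift)
    also have "cofactor (A a) 0 0 = minor ws js"
    proof -
      have "mat_delete (A a) 0 0 = mat ?n ?n (\<lambda>(a, b). (ws ! a) (js ! b))"
        by (rule eq_matI) (auto simp: mat_delete_def A_def)
      then show ?thesis by (simp add: cofactor_def minor_def)
    qed
    also have "A a $$ (0, 0) = v a" by (simp add: A_def)
    also have "(\<Sum>i<?n. A a $$ (Suc i, 0) * cofactor (A a) (Suc i) 0) = (\<Sum>i<?n. (ws ! i) a * c i)"
      unfolding c_def cof[of a _ undefined] by (rule sum.cong) (auto simp: A_def)
    finally show ?thesis .
  qed
  then show ?thesis using that by blast
qed

text \<open>Laplace expansion along the first column, where the cofactors do not depend on \<open>a\<close>, expresses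
  \<open>v\<close> as a combination of \<open>ws\<close>.\<close>

lemma in_span_if_minors_zero:
  assumes "minor ws js \<noteq> 0" "\<And>a. minor (v # ws) (a # js) = 0"
  shows "v \<in> fv.span (set ws)"
proof -
  obtain c where c: "\<And>a. minor (v # ws) (a # js) = v a * minor ws js + (\<Sum>i<length ws. (ws ! i) a * c i)"
    using minor_first_column[of v ws js] by blast
  have "v = (\<Sum>i<length ws. fscale (- c i / minor ws js) (ws ! i))"
  proof
    fix a
    have "v a * minor ws js = - (\<Sum>i<length ws. (ws ! i) a * c i)"
      using c[of a] assms(2)[of a] by (simp add: eq_neg_iff_add_eq_0)
    then have "v a = - (\<Sum>i<length ws. (ws ! i) a * c i) / minor ws js"
      using assms(1) nonzero_eq_divide_eq by blast
    then show "v a = (\<Sum>i<length ws. fscale (- c i / minor ws js) (ws ! i)) a"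
      by (simp add: sum_fun_apply fscale_def sum_divide_distrib sum_negf mult.commute)
  qed
  also have "\<dots> \<in> fv.span (set ws)"
    by (intro fv.span_sum fv.span_scale fv.span_base) auto
  finally show ?thesis .
qed

text \<open>Grow the column list along with the rows: if no column a completed a nonzero minor of ws
  to a nonzero minor of w # ws, then w would lie in the span.\<close>

lemma ex_minor_nonzero:
  "ind_list ws \<Longrightarrow> \<exists>js. length js = length ws \<and> minor ws js \<noteq> 0"
proof (induction ws)
  case Nil
  show ?case by (rule exI[of _ "[]"]) (simp add: minor_def)
next
  case (Cons w ws)
  have w: "w \<notin> fv.span (set ws)" "ind_list ws"
    using Cons.prems unfolding ind_list_Cons by blast+
  then obtain js where js: "length js = length ws" "minor ws js \<noteq> 0" using Cons.IH by blast
  then obtain a where "minor (w # ws) (a # js) \<noteq> 0"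
    using in_span_if_minors_zero[of ws js w] w(1) by blast
  then show ?case using js(1) by (intro exI[of _ "a # js"]) simp
qed

lemma wedge_nonzero_iff:
  fixes ws :: "(nat \<Rightarrow> 'a::field) list"
  shows "wedge ws \<noteq> 0 \<longleftrightarrow> ind_list ws"
proof
  assume "wedge ws \<noteq> 0"
  then obtain I where "wedge ws I \<noteq> 0" by (auto simp: fun_eq_iff)
  then have "minor ws (sorted_list_of_set I) \<noteq> 0" by (simp add: wedge_eq_minor split: if_splits)
  then show "ind_list ws" using alt_form_ind_list[OF alt_form_minor refl] by blast
next
  assume "ind_list ws"
  then obtain js where js: "length js = length ws" "minor ws js \<noteq> 0" using ex_minor_nonzero by blast
  obtain s :: 'a where "\<And>us. length us = length js \<Longrightarrow> minor us js = s * wedge us (set js)"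
    using minor_eq_wedge[OF minor_nonzero_distinct[OF js], where 'a = 'a] by metis
  then have "minor ws js = s * wedge ws (set js)" using js(1) by simp
  then have "wedge ws (set js) \<noteq> 0" using js(2) by (metis mult_zero_right)
  then show "wedge ws \<noteq> 0" by auto
qed

text \<open>Let js list I. Expanding the minor of v # ws in the columns a # js along v meets only
  the coordinates at I and at its exchanges, so the expansions for ws and ws' are proportional. For
  v in ws' the latter is 0, hence so is the former, for every a.\<close>

lemma subset_span_if_swaps_eq:
  fixes ws ws' :: "(nat \<Rightarrow> 'a::field) list"
  assumes len: "length ws = card I" "length ws' = card I" and I: "finite I" "wedge ws I \<noteq> 0"
    and c: "c \<noteq> 0" "wedge ws' I = c * wedge ws I"
    and swap: "\<And>a b. a \<notin> I \<Longrightarrow> b \<in> I \<Longrightarrow>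
      wedge ws' (insert a (I - {b})) = c * wedge ws (insert a (I - {b}))"
  shows "set ws' \<subseteq> fv.span (set ws)"
proof
  fix v assume v: "v \<in> set ws'"
  define js where "js = sorted_list_of_set I"
  have js: "set js = I" "distinct js" "length js = card I"
    using I(1) by (auto simp: js_def)
  have nz: "minor ws js \<noteq> 0" using I len by (simp add: wedge_eq_minor js_def)
  have eq: "minor (v # ws') (a # js) = c * minor (v # ws) (a # js)" for a
  proof (cases "a \<in> I")
    case True
    then show ?thesis using js len by (simp add: minor_not_distinct)
  next
    case False
    have "minor ws' (take k (a # js) @ drop (Suc k) (a # js)) =
        c * minor ws (take k (a # js) @ drop (Suc k) (a # js))" (is "minor ws' ?ks = _")
      if k: "k < Suc (card I)" for k
    proof -
      have "distinct (take k (a # js) @ (a # js) ! k # drop (Suc k) (a # js))"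
        using js False k by (simp add: id_take_nth_drop[symmetric] del: take_Suc_Cons drop_Suc_Cons)
      then have d: "distinct ?ks" and n: "(a # js) ! k \<notin> set ?ks" by auto
      have "set (a # js) = insert ((a # js) ! k) (set ?ks)"
        using js k by (subst id_take_nth_drop[of k "a # js"]) auto
      then have s: "set ?ks = insert a I - {(a # js) ! k}" using n js by auto
      \<comment> \<open>Deleting position 0 removes a and leaves I; any other position removes a
        member of I and leaves an exchange.\<close>
      have w: "wedge ws' (set ?ks) = c * wedge ws (set ?ks)"
      proof (cases k)
        case 0
        then show ?thesis using c js by simp
      next
        case (Suc k')
        then have b: "(a # js) ! k \<in> I" using js k by (metis nth_Cons_Suc nth_mem Suc_less_eq)
        then have "a \<noteq> (a # js) ! k" using False by metis
        then have "insert a I - {(a # js) ! k} = insert a (I - {(a # js) ! k})"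
          by (simp only: insert_Diff_if insert_Diff_single singleton_iff simp_thms if_False)
        then show ?thesis using swap[OF False b] s by (simp only:)
      qed
      obtain s :: 'a where "\<And>us. length us = length ?ks \<Longrightarrow> minor us ?ks = s * wedge us (set ?ks)"
        using minor_eq_wedge[OF d, where 'a = 'a] by metis
      moreover have "length ?ks = card I" using js k by (auto simp: min_def)
      ultimately show ?thesis using w len by simp
    qed
    then have t: "v ((a # js) ! k) * ((-1) ^ k * minor ws' (take k (a # js) @ drop (Suc k) (a # js))) =
        c * (v ((a # js) ! k) * ((-1) ^ k * minor ws (take k (a # js) @ drop (Suc k) (a # js))))"
      if "k < Suc (card I)" for k
      using that by (simp only: mult.left_commute)
    have "length (a # js) = Suc (length ws')" "length (a # js) = Suc (length ws)"
      using js len by simp_all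
    note first_row = this[THEN minor_first_row, of v]
    show ?thesis
      unfolding first_row sum_distrib_left len by (intro sum.cong refl t) simp
  qed
  have "minor (v # ws) (a # js) = 0" for a
  proof -
    have "minor (v # ws') (a # js) = 0"
      using alt_form_eq_0_span[OF alt_form_minor[of "length (v # ws')" "a # js"], of "[]" ws' v]
        v fv.span_base by auto
    then show ?thesis using eq[of a] c(1) by simp
  qed
  then show "v \<in> fv.span (set ws)" using in_span_if_minors_zero[OF nz] by blast
qed

lemma span_set_list:
  assumes "v \<in> fv.span (set ws)"
  shows "\<exists>c. v = (\<Sum>k<length ws. fscale (c k) (ws ! k))"
  using assms
proof (induction rule: fv.span_induct_alt)
  case base
  show ?case by (rule exI[of _ "\<lambda>_. 0"]) (simp only: fv.scale_zero_left sum.neutral_const)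
next
  case (step d s v)
  then obtain c where v: "v = (\<Sum>k<length ws. fscale (c k) (ws ! k))" by blast
  obtain k where k: "k < length ws" "ws ! k = s" using step(1) by (metis in_set_conv_nth)
  have d: "fscale d s = (\<Sum>i<length ws. if i = k then fscale d s else 0)"
    using k by (simp add: sum.delta)
  have "fscale d s + v = (\<Sum>i<length ws. fscale (if i = k then c i + d else c i) (ws ! i))"
    unfolding v by (subst d, unfold sum.distrib[symmetric], intro sum.cong refl) (use k(2) in \<open>simp add: fv.scale_left_distrib add.commute\<close>)
  then show ?case by (rule exI[of _ "\<lambda>i. if i = k then c i + d else c i"])
qed

text \<open>The factor is the determinant of the coefficient matrix; it is 0 when ws' is
  dependent.\<close>

lemma wedge_change_basis:
  assumes "length ws' = length ws" "set ws' \<subseteq> fv.span (set ws)"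
  obtains c where "wedge ws' = fscale c (wedge ws)"
proof -
  let ?n = "length ws"
  have "\<forall>a<?n. \<exists>c. ws' ! a = (\<Sum>k<?n. fscale (c k) (ws ! k))"
    using assms by (intro allI impI span_set_list) (auto dest: nth_mem)
  then obtain C where C: "\<And>a. a < ?n \<Longrightarrow> ws' ! a = (\<Sum>k<?n. fscale (C a k) (ws ! k))" by metis
  let ?C = "mat ?n ?n (\<lambda>(a, k). C a k)"
  have "minor ws' js = det ?C * minor ws js" for js
  proof -
    let ?A = "mat ?n ?n (\<lambda>(a, b). (ws ! a) (js ! b))"
    have "mat ?n ?n (\<lambda>(a, b). (ws' ! a) (js ! b)) = ?C * ?A"
      by (rule eq_matI)
        (auto simp: C sum_fun_apply fscale_def scalar_prod_def atLeast0LessThan intro!: sum.cong)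
    then have "minor ws' js = det (?C * ?A)" using assms(1) by (simp add: minor_def)
    also have "\<dots> = det ?C * minor ws js" unfolding minor_def by (rule det_mult) auto
    finally show ?thesis .
  qed
  then have "wedge ws' = fscale (det ?C) (wedge ws)"
    using assms(1) by (auto simp: wedge_eq_minor fscale_def)
  then show ?thesis using that by blast
qed

text \<open>An index set with an element outside S gives a zero column. This confines coordinates to
  subsets of {1..m}, and later to the single l-subset of {m - l + 1..m}.\<close>

lemma wedge_supp_space:
  assumes "set ws \<subseteq> supp_space S"
  shows "wedge ws \<in> supp_space {I. finite I \<and> I \<subseteq> S \<and> card I = length ws}"
proof -
  have "wedge ws I = 0" if I: "finite I" "card I = length ws" "\<not> I \<subseteq> S" for I
  proof -
    obtain i where "i \<in> I" "i \<notin> S" using I by blast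
    then show ?thesis using I assms unfolding wedge_eq_minor
      by (auto intro!: minor_zero_column[of _ _ i] simp: supp_space_def)
  qed
  moreover have "wedge ws I = 0" if "\<not> (finite I \<and> card I = length ws)" for I
    using that by (auto simp: wedge_eq_minor)
  ultimately show ?thesis unfolding supp_space_def by blast
qed

lemma wedge_unit_funs:
  assumes "finite I"
  shows "wedge (map unit_fun (sorted_list_of_set I)) = unit_fun I"
proof
  fix J
  let ?ws = "map unit_fun (sorted_list_of_set I) :: (nat \<Rightarrow> 'a) list"
  show "wedge ?ws J = unit_fun I J"
  proof (cases "J = I")
    case True
    have "mat (card I) (card I) (\<lambda>(a, b). (?ws ! a) (sorted_list_of_set I ! b)) = 1\<^sub>m (card I)"
      using nth_eq_iff_index_eq[OF distinct_sorted_list_of_set, of _ I]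
      by (intro eq_matI) (auto simp: unit_fun_def)
    then show ?thesis using True assms by (simp add: wedge_def unit_fun_def)
  next
    case False
    \<comment> \<open>The support bound leaves only subsets of I of full size, that is I
      itself.\<close>
    have "set ?ws \<subseteq> supp_space I" using assms by (auto simp: supp_space_def unit_fun_def)
    from wedge_supp_space[OF this] have "wedge ?ws J = 0"
      if "\<not> (finite J \<and> J \<subseteq> I \<and> card J = card I)"
      using that unfolding supp_space_def by auto
    then show ?thesis using False card_subset_eq[OF assms] by (auto simp: unit_fun_def)
  qed
qed

section \<open>Points of the Grassmannian\<close>

lemma linear_functionalI:
  fixes f :: "('i \<Rightarrow> 'a::field) \<Rightarrow> 'a"
  assumes "\<And>x y. f (x + y) = f x + f y" "\<And>c x. f (fscale c x) = c * f x"
  shows "Vector_Spaces.linear fscale (*) f"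
  using assms by unfold_locales (auto simp: algebra_simps)

lemma linear_coord: "Vector_Spaces.linear fscale (*) (\<lambda>x :: 'i \<Rightarrow> 'a::field. x i)"
  by (rule linear_functionalI) (auto simp: fscale_def)

lemma linear_eq_0_on_span:
  fixes f :: "('i \<Rightarrow> 'a::field) \<Rightarrow> 'a"
  assumes "Vector_Spaces.linear fscale (*) f" "\<And>s. s \<in> S \<Longrightarrow> f s = 0" "x \<in> fv.span S"
  shows "f x = 0"
proof -
  interpret f: Vector_Spaces.linear fscale "(*)" f by fact
  show ?thesis using assms(3)
    by (induction rule: fv.span_induct_alt) (simp_all only: f.zero f.add f.scale assms(2) mult_zero_right add_0)
qed

text \<open>Through this a hyperplane of the exterior power becomes an alternating form on tuples,
  to which the counting applies.\<close>

lemma alt_form_linear_wedge: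
  fixes f :: "(nat set \<Rightarrow> 'a::field) \<Rightarrow> 'a"
  assumes "Vector_Spaces.linear fscale (*) f"
  shows "alt_form n (\<lambda>ws. f (wedge ws))"
proof -
  interpret f: Vector_Spaces.linear fscale "(*)" f by fact
  have m: "alt_form n (\<lambda>ws. minor ws js)" for js :: "nat list" and n by (rule alt_form_minor)
  have madd: "minor (xs @ (x + y) # ys) js = minor (xs @ x # ys) js + minor (xs @ y # ys) js"
    and mscale: "minor (xs @ fscale c x # ys) js = c * minor (xs @ x # ys) js"
    for xs ys :: "(nat \<Rightarrow> 'a) list" and x y c and js :: "nat list"
    using m[of "length xs + length ys + 1" js] unfolding alt_form_def by blast+
  have "wedge (xs @ (x + y) # ys) = wedge (xs @ x # ys) + wedge (xs @ y # ys)"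
    for xs ys :: "(nat \<Rightarrow> 'a) list" and x y
    by (rule ext) (simp add: wedge_eq_minor madd)
  moreover have "wedge (xs @ fscale c x # ys) = fscale c (wedge (xs @ x # ys))"
    for xs ys :: "(nat \<Rightarrow> 'a) list" and x c
    by (rule ext) (simp add: wedge_eq_minor mscale fscale_def[of c "wedge _"])
  moreover have "wedge ws = 0" if "\<not> distinct ws" for ws :: "(nat \<Rightarrow> 'a) list"
    using that wedge_nonzero_iff by blast
  ultimately show ?thesis unfolding alt_form_def by (simp only: f.add f.scale f.zero simp_thms) simp
qed

section \<open>Pluecker points as classes of tuples\<close>

definition subsets_of_card :: "nat \<Rightarrow> nat \<Rightarrow> nat set set" where
  "subsets_of_card l m = {I. I \<subseteq> {1..m} \<and> card I = l}"

text \<open>The Pluecker image of the Grassmannian, described by tuples so that no subspace has to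
  be named; a nonzero \<open>wedge\<close> says that the tuple is independent.\<close>

definition grass_points :: "nat \<Rightarrow> nat \<Rightarrow> (nat set \<Rightarrow> 'a::field) set set" where
  "grass_points l m =
    {fv.span {wedge ws} | ws. length ws = l \<and> set ws \<subseteq> coord_space m \<and> wedge ws \<noteq> 0}"

lemma coord_space_eq: "coord_space m = supp_space {1..m}"
  by (simp add: coord_space_def supp_space_def)

lemma finite_subsets_of_card: "finite (subsets_of_card l m)"
  by (simp add: subsets_of_card_def)

lemma wedge_in_exterior:
  assumes "length ws = l" "set ws \<subseteq> coord_space m"
  shows "wedge ws \<in> supp_space (subsets_of_card l m)"
proof -
  have "{I. finite I \<and> I \<subseteq> {1..m} \<and> card I = length ws} = subsets_of_card l m"
    using assms(1) finite_subset[of _ "{1..m}"] by (auto simp: subsets_of_card_def)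
  then show ?thesis using wedge_supp_space[of ws "{1..m}"] assms(2) by (simp add: coord_space_eq)
qed

lemma unit_fun_eq_wedge:
  assumes "I \<in> subsets_of_card l m"
  obtains ws :: "(nat \<Rightarrow> 'a::field) list"
  where "length ws = l" "set ws \<subseteq> coord_space m" "wedge ws = unit_fun I"
proof -
  have I: "finite I" "card I = l" "I \<subseteq> {1..m}"
    using assms finite_subset[of I "{1..m}"] by (auto simp: subsets_of_card_def)
  show ?thesis
    by (rule that[of "map unit_fun (sorted_list_of_set I)"])
      (use I in \<open>auto simp: wedge_unit_funs coord_space_def unit_fun_def\<close>)
qed

lemma span_subset_iff: "fv.subspace U \<Longrightarrow> fv.span {x} \<subseteq> U \<longleftrightarrow> x \<in> U"
  using fv.span_minimal[of "{x}" U] fv.span_base[of x "{x}"] by auto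

lemma grass_points_subset: "grass_points l m \<subseteq> Pow (supp_space (subsets_of_card l m))"
proof
  fix p :: "(nat set \<Rightarrow> 'a) set" assume "p \<in> grass_points l m"
  then obtain ws where "p = fv.span {wedge ws}" "length ws = l" "set ws \<subseteq> coord_space m"
    by (auto simp: grass_points_def)
  then show "p \<in> Pow (supp_space (subsets_of_card l m))"
    using wedge_in_exterior[of ws l m] span_subset_iff[OF subspace_supp_space, of "wedge ws"] by blast
qed

lemma finite_grass_points: "finite (grass_points l m :: (nat set \<Rightarrow> 'a::{field,finite}) set set)"
  using finite_subset[OF grass_points_subset] finite_supp_space[OF finite_subsets_of_card] by blast

lemma ex_nonzero_in_span_iff:
  assumes "Vector_Spaces.linear fscale (*) f"
  shows "(\<exists>y\<in>fv.span {x}. f y \<noteq> 0) \<longleftrightarrow> f x \<noteq> 0"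
  using linear_eq_0_on_span[OF assms, of "{x}"] fv.span_base[of x "{x}"] by blast

text \<open>Injectivity of the Pluecker map in one-sided form. It keeps all tuples over a point
  inside the span of one of them, which bounds their number.\<close>

lemma same_point_span:
  fixes ws ws' :: "(nat \<Rightarrow> 'a::field) list"
  assumes "length ws = length ws'" "wedge ws \<noteq> 0" "wedge ws' \<noteq> 0"
    "fv.span {wedge ws'} = fv.span {wedge ws}"
  shows "set ws' \<subseteq> fv.span (set ws)"
proof -
  have "wedge ws' \<in> fv.span {wedge ws}" using assms(4) fv.span_base by blast
  then obtain c where c: "wedge ws' = fscale c (wedge ws)" by (auto simp: fv.span_singleton)
  have "c \<noteq> 0" using c assms(3) by auto
  moreover obtain I where "wedge ws I \<noteq> 0" using assms(2) by (auto simp: fun_eq_iff)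
  moreover from this have "finite I" "card I = length ws" by (auto simp: wedge_eq_minor split: if_splits)
  ultimately show ?thesis
    using assms(1) by (intro subset_span_if_swaps_eq[of ws I ws' c]) (auto simp: c fscale_def)
qed

section \<open>Points missed by a hyperplane, by a subspace, and within a chart\<close>

text \<open>Taking q^(m - l) out of each of the l factors leaves, with the index reversed, the
  number of ordered bases of an l-space.\<close>

lemma prod_card_tuples:
  fixes q :: nat
  assumes "l \<le> m"
  shows "(\<Prod>i=1..l. q ^ m - q ^ (m - i)) = q ^ (l * (m - l)) * (\<Prod>i<l. q ^ l - q ^ i)"
proof -
  have "(\<Prod>i=1..l. q ^ m - q ^ (m - i)) = (\<Prod>i=1..l. q ^ (m - l) * (q ^ l - q ^ (l - i)))"
  proof (rule prod.cong)
    fix i assume "i \<in> {1..l}"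
    then have "m = (m - l) + l" "m - i = (m - l) + (l - i)" using assms by auto
    then show "q ^ m - q ^ (m - i) = q ^ (m - l) * (q ^ l - q ^ (l - i))"
      by (metis diff_mult_distrib2 power_add)
  qed simp
  also have "\<dots> = q ^ (l * (m - l)) * (\<Prod>i=1..l. q ^ l - q ^ (l - i))"
    by (simp add: prod.distrib power_mult[symmetric] mult.commute)
  also have "(\<Prod>i=1..l. q ^ l - q ^ (l - i)) = (\<Prod>i<l. q ^ l - q ^ i)"
    by (rule prod.reindex_bij_witness[of _ "\<lambda>i. l - i" "\<lambda>i. l - i"]) auto
  finally show ?thesis .
qed

lemma card_points_functional:
  fixes f :: "(nat set \<Rightarrow> 'a::{field,finite}) \<Rightarrow> 'a"
  assumes lm: "l \<le> m" and f: "Vector_Spaces.linear fscale (*) f"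
    and vs: "length vs = l" "set vs \<subseteq> coord_space m" "f (wedge vs) \<noteq> 0"
  shows "CARD('a) ^ (l * (m - l)) \<le> card {p \<in> grass_points l m. \<exists>x\<in>p. f x \<noteq> 0}"
proof -
  interpret f: Vector_Spaces.linear fscale "(*)" f by fact
  let ?q = "CARD('a)" and ?V = "coord_space m :: (nat \<Rightarrow> 'a) set"
  let ?T = "{ws. length ws = l \<and> set ws \<subseteq> ?V \<and> f (wedge ws) \<noteq> 0}"
  let ?P = "{p \<in> grass_points l m. \<exists>x\<in>p. f x \<noteq> 0}"
  let ?B = "\<Prod>i<l. ?q ^ l - ?q ^ i"
  have V: "fv.subspace ?V" "finite ?V" "card ?V = ?q ^ m"
    by (simp_all add: coord_space_eq subspace_supp_space finite_supp_space card_supp_space)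
  have f0: "wedge ws \<noteq> 0" if "f (wedge ws) \<noteq> 0" for ws using that f.zero by metis
  have "?q ^ (l * (m - l)) * ?B \<le> card ?T"
    using card_alt_form_nonzero[OF V alt_form_linear_wedge[OF f] vs] prod_card_tuples[OF lm, of ?q]
    by (simp only:)
  also have "\<dots> \<le> ?B * card ?P"
  proof (rule card_le_fibres)
    show "finite ?P" by (rule finite_subset[OF _ finite_grass_points[of l m]]) blast
    show "finite ?T" using V(2) by (rule finite_lists_length)
    show "(\<lambda>ws. fv.span {wedge ws}) ` ?T \<subseteq> ?P"
    proof (rule image_subsetI)
      fix ws assume ws: "ws \<in> ?T"
      then have "fv.span {wedge ws} \<in> grass_points l m"
        unfolding grass_points_def using f0[of ws] by blast
      moreover have "\<exists>x\<in>fv.span {wedge ws}. f x \<noteq> 0"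
        using ws ex_nonzero_in_span_iff[OF f] by blast
      ultimately show "fv.span {wedge ws} \<in> ?P" by simp
    qed
    fix p assume "p \<in> ?P"
    show "card {ws \<in> ?T. fv.span {wedge ws} = p} \<le> ?B"
    proof (cases "{ws \<in> ?T. fv.span {wedge ws} = p} = {}")
      case True
      then show ?thesis by (simp only: card.empty)
    next
      case False
      \<comment> \<open>One tuple over p fixes the subspace; all others over p are ordered bases of
        it.\<close>
      then obtain us where us: "us \<in> ?T" "fv.span {wedge us} = p" by blast
      let ?W = "fv.span (set us)"
      have ind: "ind_list us" using us f0[of us] wedge_nonzero_iff[of us] by blast
      have W: "fv.subspace ?W" "finite ?W" by (simp_all only: fv.subspace_span finite_span finite_set)
      have "{ws \<in> ?T. fv.span {wedge ws} = p} \<subseteq> {ws. length ws = l \<and> set ws \<subseteq> ?W \<and> ind_list ws}"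
      proof
        fix ws assume "ws \<in> {ws \<in> ?T. fv.span {wedge ws} = p}"
        then have ws: "length ws = l" "f (wedge ws) \<noteq> 0" "fv.span {wedge ws} = p" by auto
        have "set ws \<subseteq> ?W"
          using ws us f0[of ws] f0[of us] by (intro same_point_span) auto
        moreover have "ind_list ws" using f0[OF ws(2)] wedge_nonzero_iff[of ws] by blast
        ultimately show "ws \<in> {ws. length ws = l \<and> set ws \<subseteq> ?W \<and> ind_list ws}" using ws(1) by blast
      qed
      then have "card {ws \<in> ?T. fv.span {wedge ws} = p}
          \<le> card {ws. length ws = l \<and> set ws \<subseteq> ?W \<and> ind_list ws}"
        by (rule card_mono[OF finite_lists_length[OF W(2)]])
      also have "\<dots> = ?B"
        using card_ind_lists[OF W, of l] card_span_ind_list[OF ind] us by simp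
      finally show ?thesis .
    qed
  qed
  finally have "?B * ?q ^ (l * (m - l)) \<le> ?B * card ?P" by (simp only: mult.commute)
  moreover have "?B > 0"
    using card_field_ge_2[where 'a = 'a] by (intro prod_pos) (auto intro!: power_strict_increasing)
  ultimately show ?thesis by (simp only: mult_le_cancel1)
qed

text \<open>As \<open>a b0\<close> is invertible, any values away from b0 extend to a zero of the
  sum: \<open>?h\<close> solves for the value at b0. So at least q^(card C - 1) choices are
  excluded.\<close>

lemma card_functionals_nonzero:
  fixes a :: "'b \<Rightarrow> 'a::{field,finite}"
  assumes C: "finite C" and b0: "b0 \<in> C" "a b0 \<noteq> 0"
  shows "card {c \<in> C \<rightarrow>\<^sub>E UNIV. (\<Sum>b\<in>C. c b * a b) \<noteq> 0} \<le> CARD('a) ^ card C - CARD('a) ^ (card C - 1)"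
proof -
  let ?F = "C \<rightarrow>\<^sub>E (UNIV :: 'a set)" and ?G = "(C - {b0}) \<rightarrow>\<^sub>E (UNIV :: 'a set)"
  let ?K = "{c \<in> ?F. (\<Sum>b\<in>C. c b * a b) = 0}"
  let ?h = "\<lambda>c. c(b0 := - (\<Sum>b\<in>C - {b0}. c b * a b) / a b0)"
  have fin: "finite ?F" using C by (simp add: finite_PiE)
  have F: "card ?F = CARD('a) ^ card C" using C by (simp add: card_PiE)
  have "card ?G = CARD('a) ^ (card C - 1)" using C b0 by (simp add: card_PiE)
  moreover have "card ?G \<le> card ?K"
  proof (rule card_inj_on_le)
    show "inj_on ?h ?G"
    proof (rule inj_onI)
      fix c d assume cd: "c \<in> ?G" "d \<in> ?G" and e: "?h c = ?h d"
      show "c = d"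
      proof
        fix b
        show "c b = d b"
        proof (cases "b = b0")
          case True
          then have "b \<notin> C - {b0}" by simp
          then show ?thesis using PiE_arb[OF cd(1)] PiE_arb[OF cd(2)] by metis
        next
          case False
          then show ?thesis using fun_cong[OF e, of b] by simp
        qed
      qed
    qed
    show "?h ` ?G \<subseteq> ?K"
    proof (rule image_subsetI)
      fix c assume c: "c \<in> ?G"
      have "(\<Sum>b\<in>C. ?h c b * a b) = ?h c b0 * a b0 + (\<Sum>b\<in>C - {b0}. ?h c b * a b)"
        using C b0 by (simp add: sum.remove[of C b0])
      also have "(\<Sum>b\<in>C - {b0}. ?h c b * a b) = (\<Sum>b\<in>C - {b0}. c b * a b)"
        by (intro sum.cong) auto
      also have "?h c b0 * a b0 = - (\<Sum>b\<in>C - {b0}. c b * a b)" using b0(2) by simp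
      finally have "(\<Sum>b\<in>C. ?h c b * a b) = 0" by simp
      moreover have "?h c \<in> ?F" using c b0(1) by (auto simp: PiE_def extensional_def)
      ultimately show "?h c \<in> ?K" by simp
    qed
    show "finite ?K" using fin by simp
  qed
  moreover have "{c \<in> ?F. (\<Sum>b\<in>C. c b * a b) \<noteq> 0} = ?F - ?K" by blast
  moreover have "card (?F - ?K) = card ?F - card ?K" using fin by (intro card_Diff_subset) auto
  ultimately show ?thesis using F by simp
qed

text \<open>Double counting of the pairs of a functional vanishing on \<open>U\<close> and a point on which it
  does not vanish.\<close>

lemma card_points_outside:
  fixes U :: "(nat set \<Rightarrow> 'a::{field,finite}) set"
  assumes lm: "l \<le> m" and U: "fv.subspace U" "U \<subseteq> supp_space (subsets_of_card l m)"
    and dim: "fv.dim U + s = card (subsets_of_card l m)"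
  shows "(CARD('a) ^ s - 1) * CARD('a) ^ (l * (m - l))
    \<le> card {p \<in> grass_points l m. \<not> p \<subseteq> U} * (CARD('a) ^ s - CARD('a) ^ (s - 1))"
proof -
  let ?q = "CARD('a)"
  let ?E = "supp_space (subsets_of_card l m) :: (nat set \<Rightarrow> 'a) set"
  let ?Y = "grass_points l m :: (nat set \<Rightarrow> 'a) set set"
  have finE: "finite ?E" by (rule finite_supp_space[OF finite_subsets_of_card])
  obtain B where B: "B \<subseteq> U" "fv.independent B" "U \<subseteq> fv.span B" "card B = fv.dim U"
    using fv.basis_exists by blast
  have spanB: "fv.span B = U" by (rule fv.span_subspace[OF B(1,3) U(1)])
  obtain D where D: "B \<subseteq> D" "D \<subseteq> ?E" "fv.independent D" "?E \<subseteq> fv.span D"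
    using fv.maximal_independent_subset_extend[of B ?E] B U by blast
  have finD: "finite D" using D(2) finE finite_subset by blast
  have spanD: "fv.span D = ?E" by (rule fv.span_subspace[OF D(2,4) subspace_supp_space])
  \<comment> \<open>The coordinates along C vanish on U; their combinations \<open>f c\<close> form
    the s-dimensional space of functionals to average over.\<close>
  define C where "C = D - B"
  have finC: "finite C" using finD by (simp add: C_def)
  have "card D = card (subsets_of_card l m)"
    using fv.dim_eq_card_independent[OF D(3)] fv.dim_span[of D] spanD
      dim_supp_space[OF finite_subsets_of_card, of l m, where 'a = 'a] by metis
  then have cardC: "card C = s"
    using dim B(4) D(1) finD finite_subset[OF D(1)] unfolding C_def by (subst card_Diff_subset) auto
  \<comment> \<open>D is a basis of the exterior power only; extending it to all functions makes its
    coordinates linear functionals on the whole space.\<close>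
  define E where "E = fv.extend_basis D"
  have E: "D \<subseteq> E" "fv.independent E" "fv.span E = UNIV"
    using fv.extend_basis_superset[OF D(3)] fv.independent_extend_basis[OF D(3)]
      fv.span_extend_basis[OF D(3)] by (simp_all add: E_def)
  define r where "r x b = fv.representation E x b" for x b
  have lin_r: "Vector_Spaces.linear fscale (*) (\<lambda>x. r x b)" for b
    unfolding r_def by (rule fv.linear_representation[OF E(2,3)])
  have r_add: "r (x + y) b = r x b + r y b" and r_scale: "r (fscale k x) b = k * r x b" for x y k b
  proof -
    interpret r: Vector_Spaces.linear fscale "(*)" "\<lambda>x. r x b" by (rule lin_r)
    show "r (x + y) b = r x b + r y b" "r (fscale k x) b = k * r x b" by (rule r.add, rule r.scale)
  qed
  define f where "f c x = (\<Sum>b\<in>C. c b * r x b)" for c x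
  have lin_f: "Vector_Spaces.linear fscale (*) (f c)" for c
    by (rule linear_functionalI)
      (simp_all add: f_def r_add r_scale sum.distrib distrib_left sum_distrib_left mult.left_commute)
  have r_basis: "r b b' = (if b' = b then 1 else 0)" if "b \<in> D" for b b'
    using fv.representation_basis[OF E(2)] that E(1) by (auto simp: r_def)
  have r_B: "r x b = 0" if "x \<in> U" "b \<in> C" for x b
    by (rule linear_eq_0_on_span[OF lin_r, where S = B]) (use that D(1) r_basis spanB in \<open>auto simp: C_def\<close>)
  have r_out: "\<exists>b\<in>C. r x b \<noteq> 0" if x: "x \<in> ?E" "x \<notin> U" for x
  proof (rule ccontr)
    assume "\<not> ?thesis"
    then have r0: "r x b = 0" if "b \<in> C" for b using that by blast
    have "fv.representation E x = fv.representation D x"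
      using x(1) spanD E(1,2) by (intro fv.representation_extend) auto
    then have "x = (\<Sum>b\<in>D. fscale (r x b) b)"
      using fv.sum_representation_eq[OF D(3), of x D] x(1) spanD finD by (simp add: r_def)
    also have "\<dots> \<in> fv.span B"
    proof (intro fv.span_sum)
      fix b assume "b \<in> D"
      show "fscale (r x b) b \<in> fv.span B"
      proof (cases "b \<in> B")
        case True
        then show ?thesis by (intro fv.span_scale fv.span_base)
      next
        case False
        then have "r x b = 0" using \<open>b \<in> D\<close> r0 by (simp add: C_def)
        then show ?thesis by (simp only: fv.scale_zero_left fv.span_zero)
      qed
    qed
    finally show False using x(2) spanB by simp
  qed
  let ?F = "C \<rightarrow>\<^sub>E (UNIV :: 'a set)"
  let ?F' = "?F - {restrict (\<lambda>_. 0) C}"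
  have finF: "finite ?F" using finC by (simp add: finite_PiE)
  have cardF': "card ?F' = ?q ^ s - 1"
    using finC cardC by (subst card_Diff_singleton) (auto simp: card_PiE)
  have lower: "?q ^ (l * (m - l)) \<le> card {p \<in> ?Y. \<exists>x\<in>p. f c x \<noteq> 0}" if c: "c \<in> ?F'" for c
  proof -
    obtain b0 where b0: "b0 \<in> C" "c b0 \<noteq> 0"
      using c by (auto simp: PiE_def extensional_def fun_eq_iff split: if_splits)
    have "f c b0 = (\<Sum>b\<in>C. if b = b0 then c b else 0)"
      unfolding f_def using b0 by (intro sum.cong) (auto simp: r_basis C_def)
    then have fb0: "f c b0 \<noteq> 0" using b0 finC by (simp add: sum.delta)
    \<comment> \<open>Counting points requires a decomposable vector at which \<open>f c\<close> is
      nonzero. Unit functions are decomposable and span the exterior power, so one of them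
      serves.\<close>
    have "\<exists>I\<in>subsets_of_card l m. f c (unit_fun I) \<noteq> 0"
    proof (rule ccontr)
      assume "\<not> ?thesis"
      then have "f c x = 0" if "x \<in> unit_fun ` subsets_of_card l m" for x using that by blast
      moreover have "b0 \<in> ?E" using b0(1) D(2) unfolding C_def by blast
      then have "b0 \<in> fv.span (unit_fun ` subsets_of_card l m)"
        using supp_space_basis[OF finite_subsets_of_card, of l m, where 'a = 'a] by (simp only: simp_thms)
      ultimately have "f c b0 = 0" by (rule linear_eq_0_on_span[OF lin_f])
      then show False using fb0 by contradiction
    qed
    then obtain I where I: "I \<in> subsets_of_card l m" "f c (unit_fun I) \<noteq> 0" by blast
    obtain ws :: "(nat \<Rightarrow> 'a) list" where "length ws = l" "set ws \<subseteq> coord_space m" "wedge ws = unit_fun I"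
      using unit_fun_eq_wedge[OF I(1)] by blast
    then show ?thesis using card_points_functional[OF lm lin_f, of ws c] I(2) by simp
  qed
  have "(?q ^ s - 1) * ?q ^ (l * (m - l)) = (\<Sum>c\<in>?F'. ?q ^ (l * (m - l)))"
    by (simp only: sum_constant cardF' of_nat_id)
  also have "\<dots> \<le> (\<Sum>c\<in>?F'. card {p \<in> ?Y. \<exists>x\<in>p. f c x \<noteq> 0})"
    by (rule sum_mono) (rule lower)
  also have "\<dots> = (\<Sum>c\<in>?F'. \<Sum>p\<in>?Y. if \<exists>x\<in>p. f c x \<noteq> 0 then 1 else 0)"
    by (simp only: card_eq_sum sum.inter_filter[OF finite_grass_points])
  \<comment> \<open>From here the pairs are counted by points: a point in U occurs in none, a point
    outside U in at most q^s - q^(s - 1).\<close>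
  also have "\<dots> = (\<Sum>p\<in>?Y. \<Sum>c\<in>?F'. if \<exists>x\<in>p. f c x \<noteq> 0 then 1 else 0)"
    by (rule sum.swap)
  also have "\<dots> = (\<Sum>p\<in>?Y. card {c \<in> ?F'. \<exists>x\<in>p. f c x \<noteq> 0})"
    by (simp only: card_eq_sum sum.inter_filter[OF finite_Diff[OF finF]])
  also have "\<dots> \<le> (\<Sum>p\<in>?Y. if \<not> p \<subseteq> U then ?q ^ s - ?q ^ (s - 1) else 0)"
  proof (rule sum_mono)
    fix p assume p: "p \<in> ?Y"
    show "card {c \<in> ?F'. \<exists>x\<in>p. f c x \<noteq> 0} \<le> (if \<not> p \<subseteq> U then ?q ^ s - ?q ^ (s - 1) else 0)"
    proof (cases "p \<subseteq> U")
      case True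
      then have "f c x = 0" if "x \<in> p" for c x
        unfolding f_def using that r_B by (intro sum.neutral) auto
      then have "{c \<in> ?F'. \<exists>x\<in>p. f c x \<noteq> 0} = {}" by blast
      then show ?thesis by (simp only: card.empty)
    next
      case False
      obtain ws where ws: "p = fv.span {wedge ws}" "length ws = l" "set ws \<subseteq> coord_space m"
        using p by (auto simp: grass_points_def)
      have "wedge ws \<in> ?E" "wedge ws \<notin> U"
        using wedge_in_exterior[OF ws(2,3)] False span_subset_iff[OF U(1)] ws(1) by auto
      then obtain b0 where b0: "b0 \<in> C" "r (wedge ws) b0 \<noteq> 0" using r_out by blast
      have "{c \<in> ?F'. \<exists>x\<in>p. f c x \<noteq> 0} \<subseteq> {c \<in> ?F. f c (wedge ws) \<noteq> 0}"
        using ex_nonzero_in_span_iff[OF lin_f] ws(1) by auto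
      then have "card {c \<in> ?F'. \<exists>x\<in>p. f c x \<noteq> 0} \<le> card {c \<in> ?F. f c (wedge ws) \<noteq> 0}"
        using finF by (intro card_mono) auto
      also have "\<dots> \<le> ?q ^ s - ?q ^ (s - 1)"
        using card_functionals_nonzero[OF finC, of b0 "r (wedge ws)"] b0 cardC by (simp add: f_def)
      finally show ?thesis using False by simp
    qed
  qed
  also have "\<dots> = (\<Sum>p\<in>{p \<in> ?Y. \<not> p \<subseteq> U}. ?q ^ s - ?q ^ (s - 1))"
    by (rule sum.inter_filter[OF finite_grass_points, symmetric])
  finally show ?thesis by (simp only: sum_constant of_nat_id)
qed

text \<open>A point with nonvanishing coordinate \<open>I\<close> is determined by the coordinates of the sets
  obtained from \<open>I\<close> by exchanging one element: they are the entries of the reduced basis.\<close>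

lemma card_points_chart:
  assumes I: "I \<in> subsets_of_card l m" and K: "K \<subseteq> I \<times> ({1..m} - I)"
  shows "card {p \<in> grass_points l m :: (nat set \<Rightarrow> 'a::{field,finite}) set set.
      (\<exists>x\<in>p. x I \<noteq> 0) \<and> (\<forall>(b, a)\<in>K. \<forall>x\<in>p. x (insert a (I - {b})) = 0)}
    \<le> CARD('a) ^ (l * (m - l) - card K)" (is "card ?S \<le> _")
proof -
  let ?D = "I \<times> ({1..m} - I) - K"
  have finI: "finite I" "card I = l" "I \<subseteq> {1..m}"
    using I finite_subset[of I "{1..m}"] by (auto simp: subsets_of_card_def)
  have "\<forall>p\<in>?S. \<exists>ws. p = fv.span {wedge ws} \<and> length ws = l \<and> set ws \<subseteq> coord_space m \<and> wedge ws I \<noteq> 0"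
  proof
    fix p assume p: "p \<in> ?S"
    then obtain ws where ws: "p = fv.span {wedge ws}" "length ws = l" "set ws \<subseteq> coord_space m"
      by (auto simp: grass_points_def)
    moreover have "wedge ws I \<noteq> 0"
      using p ex_nonzero_in_span_iff[OF linear_coord[of I], of "wedge ws"] ws(1) by blast
    ultimately show "\<exists>ws. p = fv.span {wedge ws} \<and> length ws = l \<and> set ws \<subseteq> coord_space m \<and> wedge ws I \<noteq> 0"
      by blast
  qed
  from bchoice[OF this] obtain W where "\<forall>p\<in>?S. p = fv.span {wedge (W p)} \<and> length (W p) = l
      \<and> set (W p) \<subseteq> coord_space m \<and> wedge (W p) I \<noteq> 0" by blast
  then have W: "\<And>p. p \<in> ?S \<Longrightarrow> p = fv.span {wedge (W p)}" "\<And>p. p \<in> ?S \<Longrightarrow> length (W p) = l"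
      "\<And>p. p \<in> ?S \<Longrightarrow> set (W p) \<subseteq> coord_space m" "\<And>p. p \<in> ?S \<Longrightarrow> wedge (W p) I \<noteq> 0"
    by blast+
  \<comment> \<open>Ratios to the coordinate at I do not depend on the chosen tuple: they are the
    affine coordinates of the chart. The pairs of K are left out, their values being 0.\<close>
  define g where "g p = (\<lambda>(b, a)\<in>?D. wedge (W p) (insert a (I - {b})) / wedge (W p) I)" for p
  have sub: "fv.span {wedge (W p')} \<subseteq> fv.span {wedge (W p)}"
    if p: "p \<in> ?S" "p' \<in> ?S" "g p = g p'" for p p'
  proof -
    define c where "c = wedge (W p') I / wedge (W p) I"
    have "set (W p') \<subseteq> fv.span (set (W p))"
    proof (rule subset_span_if_swaps_eq)
      show "length (W p) = card I" "length (W p') = card I" using W(2) p finI by simp_all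
      show "finite I" by fact
      show "wedge (W p) I \<noteq> 0" using W(4) p by simp
      show "c \<noteq> 0" using W(4) p by (simp add: c_def)
      show "wedge (W p') I = c * wedge (W p) I" using W(4) p by (simp add: c_def)
      fix a b assume ab: "a \<notin> I" "b \<in> I"
      let ?J = "insert a (I - {b})"
      \<comment> \<open>The coordinate at an exchange vanishes because a lies outside {1..m},
        vanishes because of K, or is recorded by g.\<close>
      have "(b, a) \<in> K \<or> (b, a) \<in> ?D" if "a \<in> {1..m}"
        using ab that by (simp only: Diff_iff mem_Sigma_iff simp_thms)
      then consider "a \<notin> {1..m}" | "(b, a) \<in> K" | "(b, a) \<in> ?D" by metis
      then show "wedge (W p') ?J = c * wedge (W p) ?J"
      proof cases
        case 1
        have "wedge (W r) ?J = 0" if "r \<in> ?S" for r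
          using wedge_in_exterior[OF W(2,3)[OF that]] 1 by (auto simp: supp_space_def subsets_of_card_def)
        then show ?thesis using p by simp
      next
        case 2
        have "wedge (W r) ?J = 0" if r: "r \<in> ?S" for r
        proof -
          have "wedge (W r) \<in> r" using W(1)[OF r] fv.span_base by blast
          then show ?thesis using r 2 by blast
        qed
        then show ?thesis using p by simp
      next
        case 3
        have "g p (b, a) = g p' (b, a)" using p(3) by simp
        then show ?thesis using 3 W(4) p by (simp add: g_def c_def field_simps)
      qed
    qed
    then obtain k where "wedge (W p') = fscale k (wedge (W p))"
      using wedge_change_basis[of "W p'" "W p"] W(2) p by auto
    then show ?thesis by (auto simp: span_subset_iff fv.subspace_span fv.span_singleton)
  qed
  have "card ?S \<le> card (?D \<rightarrow>\<^sub>E (UNIV :: 'a set))"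
  proof (rule card_inj_on_le)
    show "inj_on g ?S"
    proof (rule inj_onI)
      fix p p' assume p: "p \<in> ?S" "p' \<in> ?S" "g p = g p'"
      then have "fv.span {wedge (W p')} = fv.span {wedge (W p)}"
        using sub[OF p] sub[OF p(2,1) p(3)[symmetric]] by blast
      then show "p = p'" using W(1)[OF p(1)] W(1)[OF p(2)] by (simp only:)
    qed
    show "g ` ?S \<subseteq> ?D \<rightarrow>\<^sub>E UNIV" unfolding g_def by (intro image_subsetI) (simp only: restrict_PiE_iff UNIV_I, blast)
    show "finite (?D \<rightarrow>\<^sub>E (UNIV :: 'a set))" using finI by (simp add: finite_PiE)
  qed
  also have "\<dots> = CARD('a) ^ card ?D" using finI by (simp add: card_PiE)
  also have "card ?D = l * (m - l) - card K"
    using finI K finite_subset[OF K] by (subst card_Diff_subset) (auto simp: card_cartesian_product card_Diff_subset)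
  finally show ?thesis .
qed

section \<open>The Schubert divisor\<close>

definition divisor_points :: "nat \<Rightarrow> nat \<Rightarrow> (nat set \<Rightarrow> 'a::field) set set" where
  "divisor_points l m = {p \<in> grass_points l m. \<forall>x\<in>p. x {m - l + 1..m} = 0}"

lemma flag_eq: "flag j = (supp_space {1..j} :: (nat \<Rightarrow> 'a::field) set)"
proof -
  have "std_basis = (unit_fun :: nat \<Rightarrow> nat \<Rightarrow> 'a)" by (simp add: fun_eq_iff std_basis_def unit_fun_def)
  then show ?thesis unfolding flag_def using supp_space_basis[of "{1..j}", where 'a = 'a]
    by (simp only: finite_atLeastAtMost simp_thms True_implies_equals)
qed

lemma span_subset_coord_space: "set ws \<subseteq> coord_space m \<Longrightarrow> fv.span (set ws) \<subseteq> coord_space m"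
  unfolding coord_space_eq by (intro fv.span_minimal subspace_supp_space)

text \<open>Nonempty fibres on W of the projection to the coordinates j + 1..m are translates of
  \<open>W \<inter> flag j\<close>, and the target has q^(m - j) elements; compare exponents of
  q.\<close>

lemma dim_Int_flag:
  fixes W :: "(nat \<Rightarrow> 'a::{field,finite}) set"
  assumes W: "fv.subspace W" "W \<subseteq> coord_space m" and j: "j \<le> m"
  shows "fv.dim W + j \<le> m + fv.dim (W \<inter> flag j)"
proof -
  let ?q = "CARD('a)"
  let ?f = "\<lambda>w i. if i \<in> {j + 1..m} then w i else (0 :: 'a)"
  let ?I = "W \<inter> flag j"
  have finW: "finite W" using W(2) finite_supp_space[of "{1..m}"] finite_subset by (auto simp: coord_space_eq)
  have I: "fv.subspace ?I" "finite ?I"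
    using W(1) finW by (auto simp: flag_eq intro!: fv.subspace_inter subspace_supp_space)
  have "card W \<le> card ?I * card (supp_space {j + 1..m} :: (nat \<Rightarrow> 'a) set)"
  proof (rule card_le_fibres[where f = ?f])
    show "finite (supp_space {j + 1..m} :: (nat \<Rightarrow> 'a) set)" by (rule finite_supp_space) simp
    show "?f ` W \<subseteq> supp_space {j + 1..m}" by (auto simp: supp_space_def)
    fix t
    show "card {w \<in> W. ?f w = t} \<le> card ?I"
    proof (cases "{w \<in> W. ?f w = t} = {}")
      case True
      then show ?thesis by (simp only: card.empty)
    next
      case False
      then obtain w0 where w0: "w0 \<in> W" "?f w0 = t" by blast
      show ?thesis
      proof (rule card_inj_on_le)
        show "inj_on (\<lambda>w. w - w0) {w \<in> W. ?f w = t}" by (auto simp: inj_on_def)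
        show "(\<lambda>w. w - w0) ` {w \<in> W. ?f w = t} \<subseteq> ?I"
        proof (rule image_subsetI)
          fix w assume "w \<in> {w \<in> W. ?f w = t}"
          then have w: "w \<in> W" "?f w = ?f w0" using w0 by auto
          have "(w - w0) i = 0" if "i \<notin> {1..j}" for i
          proof (cases "i \<in> {j + 1..m}")
            case True
            then show ?thesis using fun_cong[OF w(2), of i] by simp
          next
            case False
            then have i: "i \<notin> {1..m}" using that by auto
            have "w i = 0" "w0 i = 0"
              using i subsetD[OF W(2) w(1)] subsetD[OF W(2) w0(1)] unfolding coord_space_def by blast+
            then show ?thesis by simp
          qed
          then show "w - w0 \<in> ?I"
            using fv.subspace_diff[OF W(1) w(1) w0(1)] by (simp add: flag_eq supp_space_def)
        qed
      qed (rule I(2))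
    qed
  qed (rule finW)
  then have "?q ^ fv.dim W \<le> ?q ^ fv.dim ?I * ?q ^ (m - j)"
    using card_subspace[OF W(1) finW] card_subspace[OF I] card_supp_space[of "{j + 1..m}", where 'a = 'a]
    by simp
  then have "?q ^ fv.dim W \<le> ?q ^ (fv.dim ?I + (m - j))" by (simp only: power_add)
  then have "fv.dim W \<le> fv.dim ?I + (m - j)"
    using card_field_ge_2[where 'a = 'a] by (subst (asm) power_increasing_iff) auto
  then show ?thesis using j by simp
qed

text \<open>If the last minor were nonzero, expanding the vanishing minor of v # ws along v would
  leave the single term \<open>v a * minor ws js\<close>, because v is 0 on the last l coordinates.
  So v would be 0.\<close>

lemma flag_Int_nonzero_imp_wedge:
  fixes ws :: "(nat \<Rightarrow> 'a::field) list"
  assumes ws: "length ws = l" "set ws \<subseteq> coord_space m" and lm: "l \<le> m"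
    and v: "v \<in> fv.span (set ws)" "v \<in> flag (m - l)" "v \<noteq> 0"
  shows "wedge ws {m - l + 1..m} = 0"
proof (rule ccontr)
  let ?T = "{m - l + 1..m}"
  define js where "js = sorted_list_of_set ?T"
  assume "wedge ws ?T \<noteq> 0"
  then have nz: "minor ws js \<noteq> 0" using ws lm by (simp add: wedge_eq_minor js_def)
  have js: "length js = l" "set js = ?T" using lm by (simp_all add: js_def)
  have "v a = 0" for a
  proof -
    have len: "length (a # js) = Suc (length ws)" using js ws by simp
    have v0: "v (js ! k) = 0" if "k < l" for k
    proof -
      have "js ! k \<in> ?T" using that js nth_mem by blast
      then show ?thesis using v(2) by (auto simp: flag_eq supp_space_def)
    qed
    have "minor ([] @ v # ws) (a # js) = 0"
      using v(1) by (intro alt_form_eq_0_span[OF alt_form_minor[of "Suc l"]]) (simp_all add: ws)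
    then have "0 = minor (v # ws) (a # js)" by simp
    also have "\<dots> = v a * minor ws js"
      unfolding minor_first_row[OF len] sum.lessThan_Suc_shift using v0 ws by simp
    finally show ?thesis using nz by simp
  qed
  then show False using v(3) by (simp add: fun_eq_iff)
qed

text \<open>If the span meets the flag space trivially, restriction to the last l coordinates is
  injective on it, so the restricted tuple is independent. Its only possible nonzero coordinate is
  at the last l-set, where restriction changes nothing.\<close>

lemma wedge_imp_flag_Int_nonzero:
  fixes ws :: "(nat \<Rightarrow> 'a::field) list"
  assumes ws: "length ws = l" "set ws \<subseteq> coord_space m" "ind_list ws" and lm: "l \<le> m"
    and w0: "wedge ws {m - l + 1..m} = 0"
  obtains v where "v \<in> fv.span (set ws)" "v \<in> flag (m - l)" "v \<noteq> 0"
proof (rule ccontr)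
  let ?T = "{m - l + 1..m}"
  note that_v = that
  assume "\<not> thesis"
  then have no: "v = 0" if "v \<in> fv.span (set ws)" "v \<in> flag (m - l)" for v
    using that that_v by blast
  define R where "R x = (\<lambda>i. if i \<in> ?T then x i else (0 :: 'a))" for x
  have W: "fv.span (set ws) \<subseteq> coord_space m" by (rule span_subset_coord_space[OF ws(2)])
  have inj: "w = u" if wu: "w \<in> fv.span (set ws)" "u \<in> fv.span (set ws)" "R w = R u" for w u
  proof -
    have d: "w - u \<in> fv.span (set ws)" using wu by (intro fv.span_diff)
    have "(w - u) i = 0" if i: "i \<notin> {1..m - l}" for i
    proof (cases "i \<in> ?T")
      case True
      then show ?thesis using fun_cong[OF wu(3), of i] by (simp add: R_def)
    next
      case False
      then have "i \<notin> {1..m}" using i lm by auto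
      then show ?thesis using subsetD[OF W d] unfolding coord_space_def by blast
    qed
    then have "w - u \<in> flag (m - l)" unfolding flag_eq supp_space_def by blast
    then show ?thesis using no[OF d] by simp
  qed
  have R_span: "\<exists>u\<in>fv.span S. x = R u" if "x \<in> fv.span (R ` S)" for x S
    using that
  proof (induction rule: fv.span_induct_alt)
    case base
    have "0 = R 0" by (simp add: R_def fun_eq_iff)
    then show ?case using fv.span_zero by blast
  next
    case (step c s y)
    then obtain u s' where us: "u \<in> fv.span S" "y = R u" "s' \<in> S" "s = R s'" by blast
    have "fscale c (R s') + R u = R (fscale c s' + u)" by (simp add: R_def fun_eq_iff fscale_def)
    moreover have "fscale c s' + u \<in> fv.span S"
      by (rule fv.span_add[OF fv.span_scale[OF fv.span_base[OF us(3)]] us(1)])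
    ultimately show ?case using us by metis
  qed
  have "ind_list (map R us)" if "set us \<subseteq> set ws" "ind_list us" for us
    using that
  proof (induction us)
    case (Cons u us)
    have u: "u \<notin> fv.span (set us)" "ind_list us" using Cons.prems(2) unfolding ind_list_Cons by blast+
    have "R u \<notin> fv.span (set (map R us))"
    proof
      assume "R u \<in> fv.span (set (map R us))"
      then obtain u' where u': "u' \<in> fv.span (set us)" "R u = R u'" using R_span[of _ "set us"] by auto
      have "u' \<in> fv.span (set ws)" using u'(1) Cons.prems(1) fv.span_mono[of "set us" "set ws"] by auto
      moreover have "u \<in> fv.span (set ws)" using Cons.prems(1) fv.span_base by auto
      ultimately have "u = u'" using inj u'(2) by blast
      then show False using u' u(1) by simp
    qed
    moreover have "ind_list (map R us)" using Cons.IH Cons.prems(1) u(2) by simp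
    ultimately show ?case unfolding list.map ind_list_Cons by blast
  qed simp
  then have "wedge (map R ws) \<noteq> 0" using ws(3) wedge_nonzero_iff by blast
  then obtain I where I: "wedge (map R ws) I \<noteq> 0" by (auto simp: fun_eq_iff)
  have "set (map R ws) \<subseteq> supp_space ?T" by (auto simp: R_def supp_space_def)
  from wedge_supp_space[OF this] have "I \<subseteq> ?T" "card I = l"
    using I ws(1) unfolding supp_space_def by auto
  then have "I = ?T" using lm by (intro card_subset_eq) auto
  moreover have "wedge (map R ws) ?T = wedge ws ?T"
  proof -
    have "sorted_list_of_set ?T ! b \<in> ?T" if "b < l" for b
      using that lm nth_mem[of b "sorted_list_of_set ?T"] by simp
    then show ?thesis
      using ws(1) unfolding wedge_def
      by (auto intro!: arg_cong[where f = det] eq_matI simp: R_def)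
  qed
  ultimately show False using I w0 by simp
qed

lemma schubert_condition_iff:
  fixes ws :: "(nat \<Rightarrow> 'a::{field,finite}) list"
  assumes lm: "1 < l" "l < m" and ws: "length ws = l" "set ws \<subseteq> coord_space m" "ind_list ws"
  shows "fv.span (set ws) \<in> schubert_variety l m (divisor_index l m) \<longleftrightarrow> wedge ws {m - l + 1..m} = 0"
proof -
  let ?W = "fv.span (set ws)"
  have W: "fv.subspace ?W" "?W \<subseteq> coord_space m"
    using span_subset_coord_space[OF ws(2)] fv.subspace_span by blast+
  have dimW: "fv.dim ?W = l"
    using ws fv.dim_eq_card_independent fv.dim_span by (metis distinct_card)
  let ?I = "?W \<inter> flag (m - l)"
  have I: "fv.subspace ?I" "finite ?I"
    using W finite_supp_space[of "{1..m - l}", where 'a = 'a]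
    by (auto simp: flag_eq intro!: fv.subspace_inter subspace_supp_space)
  \<comment> \<open>For i \<ge> 2 the flag space has codimension l - i in the ambient space, so
    every l-space satisfies the condition; only i = 1 is a constraint.\<close>
  have rest: "i \<le> fv.dim (?W \<inter> flag (divisor_index l m i))" if "i \<in> {1..l}" "i \<noteq> 1" for i
  proof -
    have "i \<le> l" using that by simp
    then have "m - l + i \<le> m" using lm by arith
    from dim_Int_flag[OF W this] show ?thesis
      using that lm unfolding dimW by (simp add: divisor_index_def)
  qed
  have "?W \<in> schubert_variety l m (divisor_index l m) \<longleftrightarrow> 1 \<le> fv.dim ?I"
  proof
    assume "?W \<in> schubert_variety l m (divisor_index l m)"
    then have "1 \<le> fv.dim (?W \<inter> flag (divisor_index l m 1))"
      using lm unfolding schubert_variety_def by auto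
    then show "1 \<le> fv.dim ?I" by (simp add: divisor_index_def)
  next
    assume d: "1 \<le> fv.dim ?I"
    have "i \<le> fv.dim (?W \<inter> flag (divisor_index l m i))" if "i \<in> {1..l}" for i
      using rest[OF that] d by (cases "i = 1") (simp_all add: divisor_index_def)
    moreover have "?W \<in> grassmannian l m" using W dimW unfolding grassmannian_def by blast
    ultimately show "?W \<in> schubert_variety l m (divisor_index l m)" unfolding schubert_variety_def by blast
  qed
  also have "\<dots> \<longleftrightarrow> (\<exists>v\<in>?I. v \<noteq> 0)"
  proof
    assume "1 \<le> fv.dim ?I"
    then have "CARD('a) ^ 1 \<le> card ?I"
      unfolding card_subspace[OF I] using card_field_ge_2[where 'a = 'a] by (intro power_increasing) auto
    then have "2 \<le> card ?I" using card_field_ge_2[where 'a = 'a] by simp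
    then have "\<not> ?I \<subseteq> {0}" using card_mono[of "{0}" ?I] by fastforce
    then show "\<exists>v\<in>?I. v \<noteq> 0" by blast
  next
    assume "\<exists>v\<in>?I. v \<noteq> 0"
    then obtain v where v: "v \<in> ?I" "v \<noteq> 0" by blast
    then have "card {0, v} \<le> card ?I" using fv.subspace_0[OF I(1)] I(2) by (intro card_mono) auto
    then have "card ?I \<noteq> 1" using v by auto
    then show "1 \<le> fv.dim ?I" using card_subspace[OF I] by (cases "fv.dim ?I") auto
  qed
  also have "\<dots> \<longleftrightarrow> wedge ws {m - l + 1..m} = 0"
    using flag_Int_nonzero_imp_wedge[OF ws(1,2)] wedge_imp_flag_Int_nonzero[OF ws] lm
    by (metis Int_iff less_imp_le)
  finally show ?thesis .
qed

lemma schubert_system_eq: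
  assumes lm: "1 < l" "l < m"
  shows "schubert_system l m (divisor_index l m) = (divisor_points l m :: (nat set \<Rightarrow> 'a::{field,finite}) set set)"
proof (intro subset_antisym subsetI)
  fix p :: "(nat set \<Rightarrow> 'a) set"
  assume "p \<in> schubert_system l m (divisor_index l m)"
  then obtain W ws where p: "p = fv.span {wedge ws}" and W: "W \<in> schubert_variety l m (divisor_index l m)"
    and ob: "ordered_basis W ws"
    unfolding schubert_system_def by blast
  have ind: "ind_list ws" and sp: "W = fv.span (set ws)" using ob by (auto simp: ordered_basis_def)
  have "fv.dim W = l" "W \<subseteq> coord_space m"
    using W by (auto simp: schubert_variety_def grassmannian_def)
  then have ws: "length ws = l" "set ws \<subseteq> coord_space m"
    using ind sp fv.dim_eq_card_independent[of "set ws"] fv.dim_span[of "set ws"] fv.span_superset[of "set ws"]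
    by (auto simp: distinct_card)
  have "wedge ws {m - l + 1..m} = 0" using schubert_condition_iff[OF lm ws ind] W sp by simp
  then have "\<forall>x\<in>p. x {m - l + 1..m} = 0"
    using ex_nonzero_in_span_iff[OF linear_coord[of "{m - l + 1..m}"], of "wedge ws"] p by blast
  moreover have "p \<in> grass_points l m"
    using ws p ind wedge_nonzero_iff[of ws] unfolding grass_points_def by blast
  ultimately show "p \<in> divisor_points l m" by (simp add: divisor_points_def)
next
  fix p :: "(nat set \<Rightarrow> 'a) set"
  assume p: "p \<in> divisor_points l m"
  then obtain ws where ws: "p = fv.span {wedge ws}" "length ws = l" "set ws \<subseteq> coord_space m" "wedge ws \<noteq> 0"
    unfolding divisor_points_def grass_points_def by blast
  have ind: "ind_list ws" using ws(4) wedge_nonzero_iff by blast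
  have "wedge ws \<in> p" using ws(1) fv.span_base by blast
  then have "wedge ws {m - l + 1..m} = 0" using p by (simp add: divisor_points_def)
  then have "fv.span (set ws) \<in> schubert_variety l m (divisor_index l m)"
    using schubert_condition_iff[OF lm ws(2,3) ind] by simp
  then show "p \<in> schubert_system l m (divisor_index l m)"
    unfolding schubert_system_def ordered_basis_def using ws(1) ind by blast
qed

section \<open>The span of the divisor, and matching bounds for its subspaces\<close>

lemma last_in_subsets_of_card: "l \<le> m \<Longrightarrow> {m - l + 1..m} \<in> subsets_of_card l m"
  by (auto simp: subsets_of_card_def)

lemma divisor_points_iff:
  "p \<in> divisor_points l m \<longleftrightarrow>
    p \<in> grass_points l m \<and> p \<subseteq> supp_space (subsets_of_card l m - {{m - l + 1..m}})"
  using grass_points_subset[of l m] unfolding divisor_points_def supp_space_def by blast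

lemma finite_divisor_points: "finite (divisor_points l m :: (nat set \<Rightarrow> 'a::{field,finite}) set set)"
  by (rule finite_subset[OF _ finite_grass_points[of l m]]) (auto simp: divisor_points_def)

text \<open>Every l-set other than the last one has a decomposable unit function, whose line is a
  point of the divisor; these already span the coordinate hyperplane.\<close>

lemma span_divisor_points:
  "fv.span (\<Union> (divisor_points l m :: (nat set \<Rightarrow> 'a::{field,finite}) set set)) =
    supp_space (subsets_of_card l m - {{m - l + 1..m}})" (is "fv.span (\<Union> ?X) = ?H")
proof
  show "fv.span (\<Union> ?X) \<subseteq> ?H"
    by (intro fv.span_minimal subspace_supp_space) (auto simp: divisor_points_iff)
  have "unit_fun I \<in> \<Union> ?X" if I: "I \<in> subsets_of_card l m - {{m - l + 1..m}}" for I
  proof -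
    obtain ws :: "(nat \<Rightarrow> 'a) list" where ws: "length ws = l" "set ws \<subseteq> coord_space m" "wedge ws = unit_fun I"
      using unit_fun_eq_wedge I by blast
    have "(unit_fun I :: nat set \<Rightarrow> 'a) I \<noteq> 0" by (simp add: unit_fun_def)
    then have "wedge ws \<noteq> 0" using ws(3) by auto
    then have "fv.span {wedge ws} \<in> grass_points l m" using ws unfolding grass_points_def by blast
    moreover have "wedge ws \<in> ?H" unfolding ws(3) using I by (auto simp: supp_space_def unit_fun_def)
    ultimately have "fv.span {wedge ws} \<in> ?X"
      by (simp add: divisor_points_iff span_subset_iff subspace_supp_space)
    moreover have "wedge ws \<in> fv.span {wedge ws}" by (rule fv.span_base) simp
    ultimately show ?thesis using ws(3) by auto
  qed
  then have "fv.span (unit_fun ` (subsets_of_card l m - {{m - l + 1..m}})) \<subseteq> fv.span (\<Union> ?X)"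
    by (intro fv.span_mono image_subsetI)
  then show "?H \<subseteq> fv.span (\<Union> ?X)"
    using supp_space_basis[of "subsets_of_card l m - {{m - l + 1..m}}", where 'a = 'a] finite_subsets_of_card[of l m]
    by simp
qed

text \<open>By the geometric series, (q^(r + 1) - 1) q^\<delta> is the sum times q^(r + 1) - q^r,
  and this positive factor cancels. The condition r \<le> \<delta> keeps the exponents from
  truncating.\<close>

lemma geometric_sum_le:
  fixes q N :: nat
  assumes q: "2 \<le> q" and r: "r \<le> \<delta>"
    and le: "(q ^ Suc r - 1) * q ^ \<delta> \<le> N * (q ^ Suc r - q ^ r)"
  shows "(\<Sum>i\<le>r. q ^ (\<delta> - i)) \<le> N"
proof -
  obtain p where p: "q = Suc p" using q by (cases q) auto
  \<comment> \<open>With p = q - 1 the series is summed additively, without subtracting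
    powers.\<close>
  have geo: "p * (\<Sum>i\<le>r. q ^ (\<delta> - i)) + q ^ (\<delta> - r) = q ^ Suc \<delta>"
    using r
  proof (induction r)
    case 0
    then show ?case by (simp add: p)
  next
    case (Suc r)
    have "q ^ (\<delta> - r) = q * q ^ (\<delta> - Suc r)"
      using Suc.prems by (metis Suc_diff_Suc Suc_le_lessD power_Suc)
    then show ?case using Suc by (simp add: p algebra_simps)
  qed
  have "(\<Sum>i\<le>r. q ^ (\<delta> - i)) * (q ^ Suc r - q ^ r) + q ^ \<delta>
      = q ^ r * (p * (\<Sum>i\<le>r. q ^ (\<delta> - i)) + q ^ (\<delta> - r))"
    using r by (simp add: p algebra_simps flip: power_add)
  also have "\<dots> = q ^ Suc r * q ^ \<delta>" unfolding geo by (simp add: mult_ac)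
  finally have "(\<Sum>i\<le>r. q ^ (\<delta> - i)) * (q ^ Suc r - q ^ r) = (q ^ Suc r - 1) * q ^ \<delta>"
    by (simp add: diff_mult_distrib)
  then have "(\<Sum>i\<le>r. q ^ (\<delta> - i)) * (q ^ Suc r - q ^ r) \<le> N * (q ^ Suc r - q ^ r)"
    using le by simp
  moreover have "0 < q ^ Suc r - q ^ r" using q by (simp add: p)
  ultimately show ?thesis by (simp only: mult_le_cancel2)
qed

text \<open>The complement of the divisor in the Grassmannian is an affine space with \<open>q ^ (l * (m - l))\<close>
  points, which is the first term of the bound for the Grassmannian.\<close>

lemma divisor_lower_bound:
  fixes U :: "(nat set \<Rightarrow> 'a::{field,finite}) set"
  assumes lm: "l \<le> m" and U: "fv.subspace U" "U \<subseteq> supp_space (subsets_of_card l m - {{m - l + 1..m}})"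
    and dim: "fv.dim U + r = card (subsets_of_card l m - {{m - l + 1..m}})" and r: "r \<le> l * (m - l)"
  shows "(\<Sum>i=1..r. CARD('a) ^ (l * (m - l) - i)) \<le> card {p \<in> divisor_points l m. \<not> p \<subseteq> U}"
proof -
  let ?q = "CARD('a)" and ?\<delta> = "l * (m - l)" and ?T = "{m - l + 1..m}"
  let ?Y = "grass_points l m :: (nat set \<Rightarrow> 'a) set set"
  \<comment> \<open>With no exchange conditions this is the full chart at the last set, the
    complement of the divisor.\<close>
  let ?S = "{p \<in> ?Y. (\<exists>x\<in>p. x ?T \<noteq> 0) \<and> (\<forall>(b, a)\<in>{}. \<forall>x\<in>p. x (insert a (?T - {b})) = 0)}"
  have T: "?T \<in> subsets_of_card l m" by (rule last_in_subsets_of_card[OF lm])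
  have "U \<subseteq> supp_space (subsets_of_card l m)" using U(2) by (auto simp: supp_space_def)
  moreover have "fv.dim U + Suc r = card (subsets_of_card l m)"
    using dim card_Suc_Diff1[OF finite_subsets_of_card T] by linarith
  ultimately have "(?q ^ Suc r - 1) * ?q ^ ?\<delta>
      \<le> card {p \<in> ?Y. \<not> p \<subseteq> U} * (?q ^ Suc r - ?q ^ (Suc r - 1))"
    by (rule card_points_outside[OF lm U(1)])
  then have "(\<Sum>i\<le>r. ?q ^ (?\<delta> - i)) \<le> card {p \<in> ?Y. \<not> p \<subseteq> U}"
    by (intro geometric_sum_le[OF card_field_ge_2 r]) simp
  also have "\<dots> \<le> card (?S \<union> {p \<in> divisor_points l m. \<not> p \<subseteq> U})"
    by (rule card_mono) (auto simp: divisor_points_def finite_grass_points)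
  also have "\<dots> \<le> card ?S + card {p \<in> divisor_points l m. \<not> p \<subseteq> U}" by (rule card_Un_le)
  \<comment> \<open>An upper bound is the right direction here, since the chart is taken away from a
    lower bound.\<close>
  also have "card ?S \<le> ?q ^ ?\<delta>" using card_points_chart[OF T, of "{}", where 'a = 'a] by simp
  also have "(\<Sum>i\<le>r. ?q ^ (?\<delta> - i)) = ?q ^ ?\<delta> + (\<Sum>i=1..r. ?q ^ (?\<delta> - i))"
    by (simp add: atMost_atLeast0 sum.atLeast_Suc_atMost)
  finally show ?thesis by simp
qed

text \<open>The two families are the \<open>l\<close>-sets containing a fixed \<open>(l - 1)\<close>-set and those contained
  in a fixed \<open>(l + 1)\<close>-set.\<close>

lemma ex_exchange_family:
  assumes lm: "1 < l" "l < m" and r: "r \<le> max l (m - l)"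
  obtains J :: "nat \<Rightarrow> nat set" and b a :: "nat \<Rightarrow> nat \<Rightarrow> nat" where
    "J 0 = {m - l + 1..m}" "inj_on J {..r}" "J ` {..r} \<subseteq> subsets_of_card l m"
    "\<And>i k. k < i \<Longrightarrow> i \<le> r \<Longrightarrow> b i k \<in> J i \<and> a i k \<in> {1..m} - J i \<and> J k = insert (a i k) (J i - {b i k})"
proof (cases "r \<le> m - l")
  case True
  \<comment> \<open>The element m - l + 1 - j moves down while the other l - 1 stay; j = 0 gives the
    last set, and r \<le> m - l keeps it positive.\<close>
  define J where "J j = insert (m - l + 1 - j) {m - l + 2..m}" for j
  show ?thesis
  proof (rule that[of J "\<lambda>i k. m - l + 1 - i" "\<lambda>i k. m - l + 1 - k"])
    show "J 0 = {m - l + 1..m}" using lm by (auto simp: J_def)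
    show "inj_on J {..r}"
    proof (rule inj_onI)
      fix x y assume xy: "x \<in> {..r}" "y \<in> {..r}" "J x = J y"
      have "m - l + 1 - x \<in> J y" unfolding xy(3)[symmetric] by (simp add: J_def)
      then have "m - l + 1 - x = m - l + 1 - y" by (simp add: J_def) linarith
      then show "x = y" using xy(1,2) True by simp
    qed
    show "J ` {..r} \<subseteq> subsets_of_card l m"
    proof (rule image_subsetI)
      fix j assume j: "j \<in> {..r}"
      have "card (J j) = l" using lm by (simp add: J_def)
      moreover have "J j \<subseteq> {1..m}" using j True lm by (auto simp: J_def)
      ultimately show "J j \<in> subsets_of_card l m" by (simp add: subsets_of_card_def)
    qed
    fix i k assume ik: "k < i" "i \<le> r"
    then show "m - l + 1 - i \<in> J i \<and> m - l + 1 - k \<in> {1..m} - J i \<and>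
        J k = insert (m - l + 1 - k) (J i - {m - l + 1 - i})"
      using True lm by (auto simp: J_def)
  qed
next
  case False
  then have rl: "r \<le> l" using r by auto
  \<comment> \<open>Leaving out the smallest element, at j = 0, gives the last set; r \<le> l keeps
    m - l + j inside. Passing from J i to J k puts m - l + i back and takes m - l + k out.\<close>
  define J where "J j = {m - l..m} - {m - l + j}" for j
  show ?thesis
  proof (rule that[of J "\<lambda>i k. m - l + k" "\<lambda>i k. m - l + i"])
    show "J 0 = {m - l + 1..m}" by (auto simp: J_def)
    show "inj_on J {..r}"
    proof (rule inj_onI)
      fix x y assume xy: "x \<in> {..r}" "y \<in> {..r}" "J x = J y"
      have "m - l + x \<notin> J y" unfolding xy(3)[symmetric] by (simp add: J_def)
      moreover have "m - l + x \<le> m" using xy(1) rl lm by simp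
      ultimately show "x = y" by (simp add: J_def)
    qed
    show "J ` {..r} \<subseteq> subsets_of_card l m"
    proof (rule image_subsetI)
      fix j assume j: "j \<in> {..r}"
      have "m - l + j \<in> {m - l..m}" using lm j rl by auto
      then have "card (J j) = card {m - l..m} - 1" unfolding J_def by (rule card_Diff_singleton)
      then have "card (J j) = l" using lm by simp
      moreover have "J j \<subseteq> {1..m}" using lm by (auto simp: J_def)
      ultimately show "J j \<in> subsets_of_card l m" by (simp add: subsets_of_card_def)
    qed
    fix i k assume ik: "k < i" "i \<le> r"
    then show "m - l + k \<in> J i \<and> m - l + i \<in> {1..m} - J i \<and>
        J k = insert (m - l + i) (J i - {m - l + k})"
      using rl lm by (auto simp: J_def)
  qed
qed

text \<open>Stratify the points by the first \<open>i\<close> for which the coordinate \<open>J i\<close> does not vanish.\<close>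

lemma divisor_attained:
  assumes lm: "1 < l" "l < m" and r: "r \<le> max l (m - l)"
  obtains J where "J 0 = {m - l + 1..m}" "inj_on J {..r}" "J ` {..r} \<subseteq> subsets_of_card l m"
    "card {p \<in> divisor_points l m :: (nat set \<Rightarrow> 'a::{field,finite}) set set. \<exists>i\<in>{1..r}. \<exists>x\<in>p. x (J i) \<noteq> 0}
      \<le> (\<Sum>i=1..r. CARD('a) ^ (l * (m - l) - i))"
proof -
  obtain J b a where J: "J 0 = {m - l + 1..m}" "inj_on J {..r}" "J ` {..r} \<subseteq> subsets_of_card l m"
    and ex: "\<And>i k. k < i \<Longrightarrow> i \<le> r \<Longrightarrow>
      b i k \<in> J i \<and> a i k \<in> {1..m} - J i \<and> J k = insert (a i k) (J i - {b i k})"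
    using ex_exchange_family[OF lm r] by blast
  \<comment> \<open>The exchanges that lead from J i to the earlier J k. On stratum i they are i
    vanishing chart coordinates, distinct because J is injective.\<close>
  define K where "K i = (\<lambda>k. (b i k, a i k)) ` {..<i}" for i
  let ?Y = "grass_points l m :: (nat set \<Rightarrow> 'a) set set"
  let ?S = "\<lambda>i. {p \<in> ?Y. (\<exists>x\<in>p. x (J i) \<noteq> 0) \<and> (\<forall>(b, a)\<in>K i. \<forall>x\<in>p. x (insert a (J i - {b})) = 0)}"
  have cardS: "card (?S i) \<le> CARD('a) ^ (l * (m - l) - i)" if i: "i \<in> {1..r}" for i
  proof -
    have "inj_on (\<lambda>k. (b i k, a i k)) {..<i}"
    proof (rule inj_onI)
      fix k k' assume k: "k \<in> {..<i}" "k' \<in> {..<i}" "(b i k, a i k) = (b i k', a i k')"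
      then have "J k = J k'" using ex[of k i] ex[of k' i] i by auto
      then show "k = k'" using J(2) k i by (auto simp: inj_on_def)
    qed
    then have "card (K i) = i" by (simp add: K_def card_image)
    moreover have "K i \<subseteq> J i \<times> ({1..m} - J i)"
      unfolding K_def by (rule image_subsetI) (use ex[of _ i] i in auto)
    moreover have "J i \<in> subsets_of_card l m" using J(3) i by auto
    ultimately show ?thesis using card_points_chart[of "J i" l m "K i", where 'a = 'a] by simp
  qed
  have "{p \<in> divisor_points l m. \<exists>i\<in>{1..r}. \<exists>x\<in>p. x (J i) \<noteq> 0} \<subseteq> (\<Union>i\<in>{1..r}. ?S i)"
  proof
    fix p :: "(nat set \<Rightarrow> 'a) set"
    assume "p \<in> {p \<in> divisor_points l m. \<exists>i\<in>{1..r}. \<exists>x\<in>p. x (J i) \<noteq> 0}"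
    then have p: "p \<in> ?Y" "\<forall>x\<in>p. x (J 0) = 0" "\<exists>i. i \<le> r \<and> (\<exists>x\<in>p. x (J i) \<noteq> 0)"
      unfolding divisor_points_def J(1) by auto
    define i where "i = (LEAST i. i \<le> r \<and> (\<exists>x\<in>p. x (J i) \<noteq> 0))"
    have i: "i \<le> r" "\<exists>x\<in>p. x (J i) \<noteq> 0" using LeastI_ex[OF p(3)] by (simp_all only: i_def)
    have least: "\<forall>x\<in>p. x (J k) = 0" if "k < i" for k
      using not_less_Least[OF that[unfolded i_def]] that i(1) by auto
    \<comment> \<open>Index 0 is the last set, whose coordinate vanishes on the divisor.\<close>
    have "i \<noteq> 0" using i(2) p(2) by metis
    moreover have "\<forall>(b', a')\<in>K i. \<forall>x\<in>p. x (insert a' (J i - {b'})) = 0"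
    proof (clarsimp simp: K_def)
      fix k x assume "k < i" "x \<in> p"
      then show "x (insert (a i k) (J i - {b i k})) = 0" using least[of k] ex[of k i] i(1) by metis
    qed
    ultimately have "i \<in> {1..r}" "p \<in> ?S i" using i p(1) by auto
    then show "p \<in> (\<Union>i\<in>{1..r}. ?S i)" by blast
  qed
  then have "card {p \<in> divisor_points l m :: (nat set \<Rightarrow> 'a) set set. \<exists>i\<in>{1..r}. \<exists>x\<in>p. x (J i) \<noteq> 0}
      \<le> card (\<Union>i\<in>{1..r}. ?S i)"
    by (rule card_mono[rotated]) (rule finite_subset[OF _ finite_grass_points[of l m]], blast)
  also have "\<dots> \<le> (\<Sum>i=1..r. card (?S i))" by (rule card_UN_le) simp
  also have "\<dots> \<le> (\<Sum>i=1..r. CARD('a) ^ (l * (m - l) - i))" by (rule sum_mono) (rule cardS)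
  finally show ?thesis by (rule that[OF J])
qed

section \<open>Higher weights and minimum distance\<close>

text \<open>Keeps every exponent \<delta> - i free of truncation, as
  \<open>divisor_lower_bound\<close> requires.\<close>

lemma max_le_mult: "1 < l \<Longrightarrow> l < m \<Longrightarrow> max l (m - l) \<le> l * (m - l)" for l m :: nat
  using mult_le_mono[of 1 "m - l" l l] mult_le_mono[of 1 l "m - l" "m - l"] by (simp add: mult.commute)

lemma higher_weight_divisor:
  assumes lm: "1 < l" "l < m" and r: "r \<le> max l (m - l)"
  shows "higher_weight (divisor_points l m :: (nat set \<Rightarrow> 'a::{field,finite}) set set) r =
    (\<Sum>i=1..r. CARD('a) ^ (l * (m - l) - i))"
proof -
  let ?X = "divisor_points l m :: (nat set \<Rightarrow> 'a) set set"
  let ?E = "subsets_of_card l m - {{m - l + 1..m}}"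
  let ?H = "supp_space ?E :: (nat set \<Rightarrow> 'a) set"
  let ?s = "\<Sum>i=1..r. CARD('a) ^ (l * (m - l) - i)"
  let ?M = "{card {p \<in> ?X. p \<subseteq> U} | U. fv.subspace U \<and> U \<subseteq> fv.span (\<Union>?X) \<and>
    fv.dim U + r = fv.dim (fv.span (\<Union>?X))}"
  have finX: "finite ?X" by (rule finite_divisor_points)
  have finE: "finite ?E" using finite_subsets_of_card by simp
  have dimH: "fv.dim ?H = card ?E" by (rule dim_supp_space[OF finE])
  \<comment> \<open>Turns the largest section by a subspace into the fewest points outside
    it.\<close>
  have compl: "card {p \<in> ?X. p \<subseteq> U} + card {p \<in> ?X. \<not> p \<subseteq> U} = card ?X" for U
    using finX by (subst card_Un_disjoint[symmetric]) (auto intro!: arg_cong[where f = card])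
  have lower: "?s \<le> card {p \<in> ?X. \<not> p \<subseteq> U}"
    if "fv.subspace U" "U \<subseteq> ?H" "fv.dim U + r = card ?E" for U
    using divisor_lower_bound[OF _ that] lm r max_le_mult[OF lm] by simp
  obtain J where J: "J 0 = {m - l + 1..m}" "inj_on J {..r}" "J ` {..r} \<subseteq> subsets_of_card l m"
    "card {p \<in> ?X. \<exists>i\<in>{1..r}. \<exists>x\<in>p. x (J i) \<noteq> 0} \<le> ?s"
    by (rule divisor_attained[OF lm r, where 'a = 'a])
  \<comment> \<open>Index 0 is among the r + 1 coordinates set to zero; this places U0 in the span
    of the divisor and makes its codimension there r.\<close>
  define U0 where "U0 = (supp_space (subsets_of_card l m - J ` {..r}) :: (nat set \<Rightarrow> 'a) set)"
  have U0: "fv.subspace U0" "U0 \<subseteq> ?H"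
    unfolding U0_def J(1)[symmetric] by (rule subspace_supp_space) (auto simp: supp_space_def)
  have "card (J ` {..r}) = Suc r" using J(2) by (simp add: card_image)
  moreover have "card (J ` {..r}) \<le> card (subsets_of_card l m)"
    by (rule card_mono[OF finite_subsets_of_card J(3)])
  moreover have "card ?E = card (subsets_of_card l m) - 1"
    using last_in_subsets_of_card[of l m] lm by (intro card_Diff_singleton) auto
  moreover have "fv.dim U0 = card (subsets_of_card l m) - card (J ` {..r})"
    unfolding U0_def using J(3) finite_subsets_of_card[of l m] by (subst dim_supp_space) (auto simp: card_Diff_subset)
  ultimately have dimU0: "fv.dim U0 + r = card ?E" by linarith
  have "{p \<in> ?X. \<not> p \<subseteq> U0} \<subseteq> {p \<in> ?X. \<exists>i\<in>{1..r}. \<exists>x\<in>p. x (J i) \<noteq> 0}"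
  proof
    fix p assume "p \<in> {p \<in> ?X. \<not> p \<subseteq> U0}"
    then obtain x where p: "p \<in> ?X" "x \<in> p" "x \<notin> U0" by blast
    then have "x \<in> ?H" by (auto simp: divisor_points_iff)
    then obtain i where i: "i \<le> r" "x (J i) \<noteq> 0" using p(3) unfolding U0_def supp_space_def by blast
    have "i \<noteq> 0"
    proof
      assume "i = 0"
      then show False using i(2) \<open>x \<in> ?H\<close> J(1) by (simp add: supp_space_def)
    qed
    then have "i \<in> {1..r}" using i(1) by simp
    then show "p \<in> {p \<in> ?X. \<exists>i\<in>{1..r}. \<exists>x\<in>p. x (J i) \<noteq> 0}" using p(1,2) i(2) by blast
  qed
  then have "card {p \<in> ?X. \<not> p \<subseteq> U0} \<le> card {p \<in> ?X. \<exists>i\<in>{1..r}. \<exists>x\<in>p. x (J i) \<noteq> 0}"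
    by (rule card_mono[rotated]) (rule finite_subset[OF _ finX], blast)
  with J(4) lower[OF U0 dimU0] have eq: "card {p \<in> ?X. \<not> p \<subseteq> U0} = ?s" by linarith
  have "Max ?M = card ?X - ?s"
  proof (rule Max_eqI)
    show "finite ?M"
      by (rule finite_subset[of _ "{..card ?X}"]) (auto intro!: card_mono finX)
    show "n \<le> card ?X - ?s" if "n \<in> ?M" for n
    proof -
      obtain U where U: "n = card {p \<in> ?X. p \<subseteq> U}" "fv.subspace U" "U \<subseteq> ?H" "fv.dim U + r = card ?E"
        using \<open>n \<in> ?M\<close> unfolding span_divisor_points dimH by blast
      show ?thesis using lower[OF U(2-4)] compl[of U] U(1) by linarith
    qed
    have "card ?X - ?s = card {p \<in> ?X. p \<subseteq> U0}" using compl[of U0] eq by linarith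
    then show "card ?X - ?s \<in> ?M" unfolding span_divisor_points dimH using U0 dimU0 by blast
  qed
  then show ?thesis unfolding higher_weight_def using compl[of U0] eq by linarith
qed

text \<open>The distance of two words is the number of points on which the difference h of their
  functionals is nonzero, and the kernel of h in the span of the divisor has codimension 1.
  Different functionals may agree on that span; distinctness of the words is what excludes
  this.\<close>

lemma min_distance_divisor:
  fixes rep :: "(nat set \<Rightarrow> 'a::{field,finite}) set \<Rightarrow> nat set \<Rightarrow> 'a"
  assumes lm: "1 < l" "l < m" and rep: "representatives (divisor_points l m) rep"
  shows "min_distance (system_code (divisor_points l m) rep) = CARD('a) ^ (l * (m - l) - 1)"
proof -
  let ?X = "divisor_points l m :: (nat set \<Rightarrow> 'a) set set"
  let ?E = "subsets_of_card l m - {{m - l + 1..m}}"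
  let ?H = "supp_space ?E :: (nat set \<Rightarrow> 'a) set"
  let ?w = "CARD('a) ^ (l * (m - l) - 1)"
  let ?word = "\<lambda>f p. if p \<in> ?X then f (rep p) else 0"
  have finX: "finite ?X" by (rule finite_divisor_points)
  have finE: "finite ?E" using finite_subsets_of_card by simp
  \<comment> \<open>A point is a line and its representative a nonzero multiple of a generator, so
    the choice of \<open>rep\<close> does not affect where a functional vanishes.\<close>
  have rep_iff: "h (rep p) \<noteq> 0 \<longleftrightarrow> (\<exists>x\<in>p. h x \<noteq> 0)"
    if p: "p \<in> ?X" and h: "Vector_Spaces.linear fscale (*) h" for p h
  proof -
    interpret h: Vector_Spaces.linear fscale "(*)" h by (rule h)
    show ?thesis
    proof
      assume "h (rep p) \<noteq> 0"
      then show "\<exists>x\<in>p. h x \<noteq> 0" using rep p by (auto simp: representatives_def)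
    next
      assume nz: "\<exists>x\<in>p. h x \<noteq> 0"
      obtain y where y: "p = fv.span {y}" using p by (auto simp: divisor_points_def grass_points_def)
      obtain c where c: "rep p = fscale c y"
        using rep p unfolding representatives_def y by (auto simp: fv.span_singleton)
      have "rep p \<noteq> 0" using rep p by (auto simp: representatives_def)
      then have "c \<noteq> 0" using c by auto
      moreover have "h y \<noteq> 0" using nz y ex_nonzero_in_span_iff[OF h] by blast
      ultimately show "h (rep p) \<noteq> 0" unfolding c by (simp add: h.scale)
    qed
  qed
  have dist: "hamming_dist (?word f) (?word g) = card {p \<in> ?X. \<exists>x\<in>p. f x \<noteq> g x}"
    if f: "Vector_Spaces.linear fscale (*) f" and g: "Vector_Spaces.linear fscale (*) g" for f g
  proof -
    interpret f: Vector_Spaces.linear fscale "(*)" f by (rule f)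
    interpret g: Vector_Spaces.linear fscale "(*)" g by (rule g)
    have "Vector_Spaces.linear fscale (*) (\<lambda>x. f x - g x)"
      by (rule linear_functionalI) (simp_all add: f.add g.add f.scale g.scale algebra_simps)
    from rep_iff[OF _ this] show ?thesis
      unfolding hamming_dist_def by (intro arg_cong[where f = card]) auto
  qed
  have lower: "?w \<le> card {p \<in> ?X. \<exists>x\<in>p. f x \<noteq> g x}"
    if f: "Vector_Spaces.linear fscale (*) f" and g: "Vector_Spaces.linear fscale (*) g"
      and ne: "\<exists>p\<in>?X. \<exists>x\<in>p. f x \<noteq> g x" for f g
  proof -
    interpret f: Vector_Spaces.linear fscale "(*)" f by (rule f)
    interpret g: Vector_Spaces.linear fscale "(*)" g by (rule g)
    define h where "h x = f x - g x" for x
    have lin: "Vector_Spaces.linear fscale (*) h"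
      by (rule linear_functionalI)
        (simp_all add: h_def f.add g.add f.scale g.scale right_diff_distrib)
    let ?U = "{x \<in> ?H. h x = 0}"
    obtain p x0 where px: "p \<in> ?X" "x0 \<in> p" "f x0 \<noteq> g x0" using ne by blast
    have x0: "x0 \<in> ?H" "h x0 \<noteq> 0" using px divisor_points_iff[of p l m] by (auto simp: h_def)
    have U: "fv.dim ?U + 1 = fv.dim ?H" "fv.subspace ?U"
      using dim_kernel[OF lin subspace_supp_space finite_supp_space[OF finE] x0] by blast+
    have "(\<Sum>i=1..1. CARD('a) ^ (l * (m - l) - i)) \<le> card {p \<in> ?X. \<not> p \<subseteq> ?U}"
    proof (rule divisor_lower_bound)
      show "fv.dim ?U + 1 = card ?E" using U(1) dim_supp_space[OF finE, where 'a = 'a] by simp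
    qed (use lm U in auto)
    moreover have "{p \<in> ?X. \<not> p \<subseteq> ?U} = {p \<in> ?X. \<exists>x\<in>p. f x \<noteq> g x}"
    proof (rule Collect_cong, rule conj_cong[OF refl])
      fix p assume "p \<in> ?X"
      then have "p \<subseteq> ?H" by (simp only: divisor_points_iff)
      then have "p \<subseteq> ?U \<longleftrightarrow> (\<forall>x\<in>p. h x = 0)" by blast
      then show "\<not> p \<subseteq> ?U \<longleftrightarrow> (\<exists>x\<in>p. f x \<noteq> g x)" by (simp add: h_def)
    qed
    ultimately show ?thesis by simp
  qed
  have lin0: "Vector_Spaces.linear fscale (*) (\<lambda>_ :: nat set \<Rightarrow> 'a. 0)"
    by (rule linear_functionalI) auto
  have r1: "1 \<le> max l (m - l)" using lm by simp
  \<comment> \<open>The case r = 1 of the construction: the word of the coordinate at J 1 will have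
    minimum weight.\<close>
  obtain J :: "nat \<Rightarrow> nat set" where J: "J 0 = {m - l + 1..m}" "inj_on J {..1}" "J ` {..1} \<subseteq> subsets_of_card l m"
    "card {p \<in> ?X. \<exists>i\<in>{1..1}. \<exists>x\<in>p. x (J i) \<noteq> 0} \<le> (\<Sum>i=1..1. CARD('a) ^ (l * (m - l) - i))"
    by (rule divisor_attained[OF lm r1, where 'a = 'a])
  have "J 1 \<noteq> J 0" using inj_onD[OF J(2), of 1 0] by auto
  then have J1: "J 1 \<in> ?E" using J(1,3) by auto
  then have "unit_fun (J 1) \<in> ?H" by (auto simp: supp_space_def unit_fun_def)
  have ne: "\<exists>p\<in>?X. \<exists>x\<in>p. x (J 1) \<noteq> 0"
  proof (rule ccontr)
    assume "\<not> ?thesis"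
    then have "x (J 1) = 0" if "x \<in> \<Union>?X" for x using that by blast
    moreover have "unit_fun (J 1) \<in> fv.span (\<Union>?X)"
      unfolding span_divisor_points by fact
    ultimately have "(unit_fun (J 1) :: nat set \<Rightarrow> 'a) (J 1) = 0"
      by (rule linear_eq_0_on_span[OF linear_coord[of "J 1"]])
    then show False by (simp add: unit_fun_def)
  qed
  show ?thesis
    unfolding min_distance_def
  proof (rule Min_eqI)
    show "finite {hamming_dist c d |c d. c \<in> system_code ?X rep \<and> d \<in> system_code ?X rep \<and> c \<noteq> d}"
      by (rule finite_subset[of _ "{..card ?X}"])
        (auto simp: system_code_def dist intro!: card_mono finX)
    show "?w \<le> n"
      if n: "n \<in> {hamming_dist c d |c d. c \<in> system_code ?X rep \<and> d \<in> system_code ?X rep \<and> c \<noteq> d}" for n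
    proof -
      obtain f g where fg: "Vector_Spaces.linear fscale (*) f" "Vector_Spaces.linear fscale (*) g"
        "n = hamming_dist (?word f) (?word g)" "?word f \<noteq> ?word g"
        using n by (auto simp: system_code_def)
      from fg(4) obtain p where "?word f p \<noteq> ?word g p" by blast
      then have "p \<in> ?X" "f (rep p) \<noteq> g (rep p)" by (simp_all split: if_splits)
      then have "\<exists>p\<in>?X. \<exists>x\<in>p. f x \<noteq> g x" using rep by (auto simp: representatives_def)
      then show ?thesis using lower[OF fg(1,2)] dist[OF fg(1,2)] fg(3) by simp
    qed
    have hd: "hamming_dist (?word (\<lambda>x. x (J 1))) (?word (\<lambda>_. 0)) = ?w"
      using dist[OF linear_coord[of "J 1"] lin0] lower[OF linear_coord[of "J 1"] lin0 ne] J(4) by simp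
    moreover have "?word (\<lambda>x. x (J 1)) \<noteq> ?word (\<lambda>_. 0)"
    proof
      assume eq: "?word (\<lambda>x. x (J 1)) = ?word (\<lambda>_. 0)"
      \<comment> \<open>Equal words would be at distance 0, whereas \<open>?w\<close> is a power of
        q.\<close>
      show False using hd unfolding eq by (simp add: hamming_dist_def)
    qed
    moreover have code: "?word f \<in> system_code ?X rep" if "Vector_Spaces.linear fscale (*) f" for f
      using that unfolding system_code_def by (intro CollectI exI[of _ f] conjI refl)
    ultimately show "?w \<in> {hamming_dist c d |c d. c \<in> system_code ?X rep \<and> d \<in> system_code ?X rep \<and> c \<noteq> d}"
      using code[OF linear_coord[of "J 1"]] code[OF lin0]
      by (intro CollectI exI[of _ "?word (\<lambda>x. x (J 1))"] exI[of _ "?word (\<lambda>_. 0)"] conjI) simp_all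
  qed
qed

text \<open>The term of i = 1 is m - l - 1, and each of the other l - 1 terms is m - l.\<close>

lemma index_dim_divisor:
  assumes "1 < l" "l < m"
  shows "index_dim l (divisor_index l m) = l * (m - l) - 1"
proof -
  obtain l' where l: "l = Suc l'" using assms by (cases l) auto
  have "(\<Sum>i=1..l. divisor_index l m i - i) = (m - l - 1) + (\<Sum>i=2..l. divisor_index l m i - i)"
    using assms by (simp add: sum.atLeast_Suc_atMost numeral_2_eq_2 divisor_index_def)
  also have "(\<Sum>i=2..l. divisor_index l m i - i) = (\<Sum>i=2..l. m - l)"
    by (rule sum.cong) (auto simp: divisor_index_def)
  finally show ?thesis using assms by (simp add: index_dim_def l)
qed

theorem theorem4p1:
  fixes l m q \<delta> :: nat
    and \<eta> :: "nat \<Rightarrow> nat"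
    and X :: "(nat set \<Rightarrow> 'a::{field,finite}) set set"
  defines "q \<equiv> CARD('a)"
    and "\<delta> \<equiv> l * (m - l)"
    and "\<eta> \<equiv> divisor_index l m"
    and "X \<equiv> schubert_system l m \<eta>"
  assumes "1 < l" and "l < m"
  shows "(\<forall>r\<in>{1..max l (m - l)}. higher_weight X r = (\<Sum>i=1..r. q ^ (\<delta> - i))) \<and>
         (\<forall>rep. representatives X rep \<longrightarrow>
            min_distance (system_code X rep) = higher_weight X 1) \<and>
         higher_weight X 1 = q ^ (\<delta> - 1) \<and>
         q ^ (\<delta> - 1) = q ^ index_dim l \<eta>"
proof -
  have X: "X = divisor_points l m"
    unfolding X_def \<eta>_def by (rule schubert_system_eq[OF assms(5,6)])
  have hw: "higher_weight X r = (\<Sum>i=1..r. q ^ (\<delta> - i))" if "r \<le> max l (m - l)" for r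
    unfolding X q_def \<delta>_def by (rule higher_weight_divisor[OF assms(5,6) that])
  then have "higher_weight X 1 = q ^ (\<delta> - 1)" using hw[of 1] assms(5) by simp
  moreover have "min_distance (system_code X rep) = q ^ (\<delta> - 1)" if "representatives X rep" for rep
    using min_distance_divisor[OF assms(5,6)] that unfolding X q_def \<delta>_def by blast
  moreover have "q ^ (\<delta> - 1) = q ^ index_dim l \<eta>"
    using index_dim_divisor[OF assms(5,6)] by (simp add: \<delta>_def \<eta>_def)
  ultimately show ?thesis using hw by simp
qed

end
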